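(* Let $(\mathbf{X},d,\mu)$ be a compact metric measure space and let $\mathcal{L}$ be a self-adjoint operator in the real space $L_2(\mathbf{X},\mu)$ such that Assumptions A, B, C, D, E stated in the context are satisfied. Then there exists a constant $0<c=c(\mathbf{X})<1$, independent of $\omega$, such that for all sufficiently large $\omega$ the number $\mathcal{N}_\omega(\mathcal{L})$ of eigenvalues of $\mathcal{L}$ in $[0,\omega]$ (counted with multiplicities) satisfies $$c\,\sup\,\mathrm{card}\left(\mathcal{X}_{\omega^{-1/2}}\right)\le\mathcal{N}_\omega(\mathcal{L}),$$ where the supremum is taken over all metric $(\omega^{-1/2},N)$-lattices $\mathcal{X}_{\omega^{-1/2}}$ in $\mathbf{X}$.
   Context: Setting. $(\mathbf{X},d)$ is a compact metric space with a positive Radon measure $\mu$; $B(x,r)$ is the open ball with center $x$ and radius $r$, and $|B(x,r)|=\mu(B(x,r))$. $\|\cdot\|$ and $\langle\cdot,\cdot\rangle$ are the norm and inner product of the real space $L_2(\mathbf{X},\mu)$. Assumption A (doubling). There is $D>0$ such that $0<|B(x,2r)|\le 2^{D}|B(x,r)|$ for all $x\in\mathbf{X}$, $r>0$. Assumption B. $L_2(\mathbf{X},\mu)$ is equipped with a densely defined, non-negative symmetric operator whose closure is self-adjoint; $\mathcal{L}$ denotes this self-adjoint non-negative operator, with domain $\mathcal{D}(\mathcal{L})$. The set $\mathcal{D}^\infty(\mathcal{L})=\bigcap_{k\in\mathbb{N}}\mathcal{D}(\mathcal{L}^k)$ is a subalgebra of the algebra $C(\mathbf{X})$ of continuous functions.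 For $f,g\in\mathcal{D}^\infty(\mathcal{L})$ put $$\Gamma(f,g)=\tfrac12\left(f\mathcal{L}g+g\mathcal{L}f-\mathcal{L}(fg)\right)\in L_1(\mathbf{X},\mu).$$ Assumption C. There is a constant $c_0>0$ such that $\int_{\mathbf{X}}\Gamma(f,f)\,d\mu\le c_0\,\|\mathcal{L}^{1/2}f\|^2$ for all $f\in\mathcal{D}^\infty(\mathcal{L})$, where $\mathcal{L}^{1/2}$ is the non-negative square root. Assumption D (local Poincaré inequality). There are constants $C>0$ and $\rho_0>0$ such that for all $f\in\mathcal{D}^\infty(\mathcal{L})$, all $x\in\mathbf{X}$ and all $0<\rho<\rho_0$, $$\int_{B(x,\rho)}|f-f_B|^2\,d\mu\le C\rho^2\int_{B(x,\rho)}\Gamma(f,f)\,d\mu,\qquad f_B=\frac{1}{|B(x,\rho)|}\int_{B(x,\rho)}f\,d\mu .$$ Assumption E (short-time Gaussian estimates). The heat semigroup has a heat kernel $P_t(x,y)$, i.e. $e^{-t\mathcal{L}}f(x)=\int_{\mathbf{X}}P_t(x,y)f(y)\,d\mu(y)$, and there are positive constants $C_1,C_2,c_1,c_2$ such that for all $0<t<1$ and $x,y\in\mathbf{X}$ $$\frac{C_1e^{-c_1 d(x,y)^2/t}}{\sqrt{|B(x,\sqrt t)|\,|B(y,\sqrt t)|}}\le P_t(x,y)\le\frac{C_2e^{-c_2 d(x,y)^2/t}}{\sqrt{|B(x,\sqrt t)|\,|B(y,\sqrt t)|}} .$$ Under Assumptions A–D the spectrum of $\mathcal{L}$ is discrete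 (eigenvalues of finite multiplicity without finite accumulation points), so $\mathcal{N}_\omega(\mathcal{L})$ is well defined and finite. Lattices. For $\rho>0$, a set of points $\mathcal{X}_\rho=\{x_j\}\subset\mathbf{X}$ is a metric $(\rho,N)$-lattice if the balls $B(x_j,\rho/2)$ are pairwise disjoint, and the balls $B(x_j,\rho)$ cover $\mathbf{X}$ with multiplicity at most $N$ (every point lies in at most $N$ of these balls). Here $N=N(\mathbf{X})$ is a fixed constant, depending only on $\mathbf{X}$, for which a $(\rho,N)$-lattice exists for every sufficiently small $\rho>0$. *)

theory Defs
  imports "HOL-Analysis.Analysis"
begin

section \<open>Compact metric measure spaces and their real \<open>L\<^sub>2\<close> space\<close>

text \<open>
  On a compact metric space the Radon measures are exactly the finite Borel measures
  (regularity is automatic).  The measure is a class parameter, in the same way as the metric,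
  so that the space of square integrable functions modulo null functions is a type.
\<close>

class compact_metric_measure_space = metric_space +
  fixes mu :: "'a measure"
  assumes compact_space: "compact (UNIV :: 'a set)"
    and sets_mu: "sets mu = sets (borel :: 'a measure)"
    and mu_finite: "emeasure mu UNIV < \<infinity>"

definition square_integrable :: "('a::compact_metric_measure_space \<Rightarrow> real) \<Rightarrow> bool" where
  "square_integrable f \<longleftrightarrow> f \<in> borel_measurable mu \<and> integrable mu (\<lambda>x. (f x)\<^sup>2)"

definition l2_eq ::
    "('a::compact_metric_measure_space \<Rightarrow> real) \<Rightarrow> ('a \<Rightarrow> real) \<Rightarrow> bool" where
  "l2_eq f g \<longleftrightarrow> square_integrable f \<and> square_integrable g \<and> (AE x in mu. f x = g x)"

lemma square_integrable_0: "square_integrable (\<lambda>x. 0)"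
  by (simp add: square_integrable_def)

lemma square_integrable_mult_integrable:
  assumes "square_integrable f" "square_integrable g"
  shows "integrable mu (\<lambda>x. f x * g x)"
proof (rule Bochner_Integration.integrable_bound)
  show "integrable mu (\<lambda>x. (f x)\<^sup>2 + (g x)\<^sup>2)"
    using assms by (simp add: square_integrable_def)
  show "(\<lambda>x. f x * g x) \<in> borel_measurable mu"
    using assms by (auto simp: square_integrable_def)
  have "\<bar>a * b\<bar> \<le> a\<^sup>2 + b\<^sup>2" for a b :: real
  proof -
    have "2 * \<bar>a * b\<bar> \<le> a\<^sup>2 + b\<^sup>2"
      using sum_squares_bound[of "\<bar>a\<bar>" "\<bar>b\<bar>"] by (simp add: abs_mult)
    then show ?thesis by linarith
  qed
  then show "AE x in mu. norm (f x * g x) \<le> norm ((f x)\<^sup>2 + (g x)\<^sup>2)"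
    by simp
qed

lemma square_integrable_add:
  assumes "square_integrable f" "square_integrable g"
  shows "square_integrable (\<lambda>x. f x + g x)"
  using assms square_integrable_mult_integrable[OF assms]
  by (auto simp: square_integrable_def power2_sum mult.assoc)

lemma square_integrable_scale:
  assumes "square_integrable f"
  shows "square_integrable (\<lambda>x. a * f x)"
  using assms by (auto simp: square_integrable_def power_mult_distrib)

quotient_type (overloaded) 'a l2 = "'a::compact_metric_measure_space \<Rightarrow> real" / partial: l2_eq
proof (rule part_equivpI)
  show "\<exists>f::'a \<Rightarrow> real. l2_eq f f"
    using square_integrable_0 by (auto simp: l2_eq_def)
  show "symp l2_eq"
    by (auto simp: symp_def l2_eq_def eq_commute)
  show "transp l2_eq"
    unfolding transp_def l2_eq_def by (auto elim: eventually_elim2)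
qed

instantiation l2 :: (compact_metric_measure_space) real_inner
begin

lift_definition zero_l2 :: "'a l2" is "\<lambda>x. 0"
  by (simp add: l2_eq_def square_integrable_0)

lift_definition plus_l2 :: "'a l2 \<Rightarrow> 'a l2 \<Rightarrow> 'a l2" is "\<lambda>f g x. f x + g x"
  by (auto simp: l2_eq_def intro: square_integrable_add elim!: eventually_elim2)

lift_definition scaleR_l2 :: "real \<Rightarrow> 'a l2 \<Rightarrow> 'a l2" is "\<lambda>a f x. a * f x"
  by (auto simp: l2_eq_def intro: square_integrable_scale elim!: eventually_mono)

lift_definition uminus_l2 :: "'a l2 \<Rightarrow> 'a l2" is "\<lambda>f x. - f x"
  by (auto simp: l2_eq_def square_integrable_def)

definition "f - g = f + - (g :: 'a l2)"

lift_definition inner_l2 :: "'a l2 \<Rightarrow> 'a l2 \<Rightarrow> real" is "\<lambda>f g. \<integral>x. f x * g x \<partial>mu"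
proof -
  fix f f' g g' :: "'a \<Rightarrow> real"
  assume h: "l2_eq f f'" "l2_eq g g'"
  show "(\<integral>x. f x * g x \<partial>mu) = (\<integral>x. f' x * g' x \<partial>mu)"
    using h by (intro integral_cong_AE)
      (auto simp: l2_eq_def square_integrable_def elim!: eventually_elim2)
qed

definition "norm (f :: 'a l2) = sqrt (inner f f)"
definition "sgn (f :: 'a l2) = inverse (norm f) *\<^sub>R f"
definition "dist f (g :: 'a l2) = norm (f - g)"
definition [code del]:
  "(uniformity :: ('a l2 \<times> 'a l2) filter) = (INF e\<in>{0 <..}. principal {(x, y). dist x y < e})"
definition [code del]:
  "open (U :: 'a l2 set) \<longleftrightarrow> (\<forall>x\<in>U. eventually (\<lambda>(x', y). x' = x \<longrightarrow> y \<in> U) uniformity)"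

instance
proof
  fix f g h :: "'a l2" and a b :: real
  show "f + g + h = f + (g + h)"
    by transfer (auto simp: l2_eq_def add.assoc intro!: square_integrable_add)
  show "f + g = g + f"
    by transfer (auto simp: l2_eq_def add.commute intro!: square_integrable_add)
  show "0 + f = f"
    by transfer (auto simp: l2_eq_def)
  show "- f + f = 0"
    by transfer (auto simp: l2_eq_def square_integrable_0)
  show "f - g = f + - g"
    by (rule minus_l2_def)
  show "a *\<^sub>R (f + g) = a *\<^sub>R f + a *\<^sub>R g"
    by transfer (auto simp: l2_eq_def ring_distribs
        intro!: square_integrable_add square_integrable_scale)
  show "(a + b) *\<^sub>R f = a *\<^sub>R f + b *\<^sub>R f"
    by transfer (auto simp: l2_eq_def ring_distribs
        intro!: square_integrable_add square_integrable_scale)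
  show "a *\<^sub>R b *\<^sub>R f = (a * b) *\<^sub>R f"
    by transfer (auto simp: l2_eq_def mult.assoc intro!: square_integrable_scale)
  show "1 *\<^sub>R f = f"
    by transfer (auto simp: l2_eq_def)
  show "dist f g = norm (f - g)"
    by (rule dist_l2_def)
  show "sgn f = inverse (norm f) *\<^sub>R f"
    by (rule sgn_l2_def)
  show "(uniformity :: ('a l2 \<times> 'a l2) filter) = (INF e\<in>{0 <..}. principal {(x, y). dist x y < e})"
    by (rule uniformity_l2_def)
  show "open U \<longleftrightarrow> (\<forall>x\<in>U. eventually (\<lambda>(x', y). x' = x \<longrightarrow> y \<in> U) uniformity)"
    for U :: "'a l2 set"
    by (rule open_l2_def)
  show "inner f g = inner g f"
    by transfer (simp add: mult.commute)
  show "inner (f + g) h = inner f h + inner g h"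
    by transfer (auto simp: l2_eq_def ring_distribs square_integrable_mult_integrable)
  show "inner (a *\<^sub>R f) g = a * inner f g"
    by transfer (simp add: mult.assoc)
  show "0 \<le> inner f f"
    by transfer simp
  show "inner f f = 0 \<longleftrightarrow> f = 0"
    by transfer (auto simp: l2_eq_def square_integrable_0 square_integrable_def
        integral_nonneg_eq_0_iff_AE power2_eq_square)
  show "norm f = sqrt (inner f f)"
    by (rule norm_l2_def)
qed

end


section \<open>Unbounded operators\<close>

text \<open>
  A densely defined operator is represented by its graph; then its domain is \<^const>\<open>Domain\<close>,
  composition is \<^const>\<open>relcomp\<close>, and the closure of an operator is the topological closure of
  its graph.
\<close>

definition linear_operator :: "('h::real_vector \<times> 'h) set \<Rightarrow> bool" where
  "linear_operator A \<longleftrightarrow> subspace A \<and> single_valued A"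

definition densely_defined :: "('h::real_inner \<times> 'h) set \<Rightarrow> bool" where
  "densely_defined A \<longleftrightarrow> closure (Domain A) = UNIV"

definition symmetric_operator :: "('h::real_inner \<times> 'h) set \<Rightarrow> bool" where
  "symmetric_operator A \<longleftrightarrow> (\<forall>(f, Af)\<in>A. \<forall>(g, Ag)\<in>A. inner Af g = inner f Ag)"

definition nonneg_operator :: "('h::real_inner \<times> 'h) set \<Rightarrow> bool" where
  "nonneg_operator A \<longleftrightarrow> (\<forall>(f, Af)\<in>A. 0 \<le> inner Af f)"

definition adjoint_operator :: "('h::real_inner \<times> 'h) set \<Rightarrow> ('h \<times> 'h) set" where
  "adjoint_operator A = {(g, h). \<forall>(f, Af)\<in>A. inner Af g = inner f h}"

definition self_adjoint_operator :: "('h::real_inner \<times> 'h) set \<Rightarrow> bool" where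
  "self_adjoint_operator A \<longleftrightarrow>
     linear_operator A \<and> densely_defined A \<and> adjoint_operator A = A"

definition op_apply :: "('h \<times> 'h) set \<Rightarrow> 'h \<Rightarrow> 'h" where
  "op_apply A f = (THE g. (f, g) \<in> A)"

definition smooth_domain :: "('h \<times> 'h) set \<Rightarrow> 'h set" where
  "smooth_domain A = (\<Inter>k. Domain (A ^^ k))"

text \<open>A non-negative self-adjoint operator has exactly one non-negative square root.\<close>

definition nonneg_sqrt :: "('h::real_inner \<times> 'h) set \<Rightarrow> ('h \<times> 'h) set \<Rightarrow> bool" where
  "nonneg_sqrt A S \<longleftrightarrow> self_adjoint_operator S \<and> nonneg_operator S \<and> S O S = A"

text \<open>
  \<open>T t = exp (- t A)\<close> is the strongly continuous semigroup with infinitesimal generator \<open>- A\<close>;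
  it is determined by \<open>A\<close> for \<open>t \<ge> 0\<close>, and exists if \<open>A\<close> is self-adjoint and non-negative.
\<close>

definition generator :: "(real \<Rightarrow> 'h::real_normed_vector \<Rightarrow> 'h) \<Rightarrow> ('h \<times> 'h) set" where
  "generator T = {(f, g). ((\<lambda>t. (T t f - f) /\<^sub>R t) \<longlongrightarrow> g) (at_right 0)}"

definition heat_semigroup ::
    "('h::real_normed_vector \<times> 'h) set \<Rightarrow> (real \<Rightarrow> 'h \<Rightarrow> 'h) \<Rightarrow> bool" where
  "heat_semigroup A T \<longleftrightarrow>
     (\<forall>t\<ge>0. bounded_linear (T t)) \<and>
     T 0 = id \<and>
     (\<forall>s\<ge>0. \<forall>t\<ge>0. T (s + t) = T s \<circ> T t) \<and>
     (\<forall>f. ((\<lambda>t. T t f) \<longlongrightarrow> f) (at_right 0)) \<and>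
     generator T = {(f, - g) | f g. (f, g) \<in> A}"

definition eigenspace :: "('h::real_vector \<times> 'h) set \<Rightarrow> real \<Rightarrow> 'h set" where
  "eigenspace A \<kappa> = {f. (f, \<kappa> *\<^sub>R f) \<in> A}"

text \<open>
  The number of eigenvalues in \<open>[0, \<omega>]\<close>, with multiplicities.  Infinitely many eigenvalues
  in \<open>[0, \<omega>]\<close> would give the sum \<open>0\<close>, and an infinite-dimensional eigenspace contributes \<open>0\<close>:
  the conventions for infinite sums and dimensions can only lower the count.
\<close>

definition eigenvalue_count :: "('h::real_vector \<times> 'h) set \<Rightarrow> real \<Rightarrow> nat" where
  "eigenvalue_count A \<omega> =
     (\<Sum>\<kappa> | 0 \<le> \<kappa> \<and> \<kappa> \<le> \<omega> \<and> eigenspace A \<kappa> \<noteq> {0}. dim (eigenspace A \<kappa>))"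


section \<open>The standing assumptions\<close>

definition l2_times ::
    "'a::compact_metric_measure_space l2 \<Rightarrow> 'a l2 \<Rightarrow> 'a l2" where
  "l2_times f g = abs_l2 (\<lambda>x. rep_l2 f x * rep_l2 g x)"

text \<open>
  Elements of \<open>L\<^sub>2\<close> are classes modulo null functions, so ``is a set of continuous functions''
  means that every class in the set has a continuous representative.  The product
  \<^const>\<open>l2_times\<close> of two such classes is the class of the product of these representatives.
\<close>

definition subalgebra_of_C :: "'a::compact_metric_measure_space l2 set \<Rightarrow> bool" where
  "subalgebra_of_C V \<longleftrightarrow>
     (\<forall>f\<in>V. \<exists>\<phi>. continuous_on UNIV \<phi> \<and> f = abs_l2 \<phi>) \<and>
     subspace V \<and>
     (\<forall>f\<in>V. \<forall>g\<in>V. l2_times f g \<in> V)"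

definition Gamma ::
    "('a::compact_metric_measure_space l2 \<times> 'a l2) set \<Rightarrow> 'a l2 \<Rightarrow> 'a l2 \<Rightarrow> 'a \<Rightarrow> real" where
  "Gamma L f g = (\<lambda>x. (rep_l2 f x * rep_l2 (op_apply L g) x
                      + rep_l2 g x * rep_l2 (op_apply L f) x
                      - rep_l2 (op_apply L (l2_times f g)) x) / 2)"

definition doubling :: "'a::compact_metric_measure_space itself \<Rightarrow> bool" where
  "doubling _ \<longleftrightarrow> (\<exists>D>0. \<forall>(x::'a) r. 0 < r \<longrightarrow>
      0 < measure mu (ball x (2 * r)) \<and>
      measure mu (ball x (2 * r)) \<le> 2 powr D * measure mu (ball x r))"

definition essentially_self_adjoint_with_smooth_algebra ::
    "('a::compact_metric_measure_space l2 \<times> 'a l2) set \<Rightarrow> bool" where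
  "essentially_self_adjoint_with_smooth_algebra L \<longleftrightarrow>
     (\<exists>L0. linear_operator L0 \<and> densely_defined L0 \<and> symmetric_operator L0 \<and>
           nonneg_operator L0 \<and> L = closure L0) \<and>
     self_adjoint_operator L \<and> nonneg_operator L \<and>
     subalgebra_of_C (smooth_domain L)"

definition energy_bound :: "('a::compact_metric_measure_space l2 \<times> 'a l2) set \<Rightarrow> bool" where
  "energy_bound L \<longleftrightarrow>
     (\<exists>S. nonneg_sqrt L S \<and>
       (\<exists>c0>0. \<forall>f\<in>smooth_domain L.
          (\<integral>x. Gamma L f f x \<partial>mu) \<le> c0 * (norm (op_apply S f))\<^sup>2))"

definition ball_average :: "('a::compact_metric_measure_space \<Rightarrow> real) \<Rightarrow> 'a \<Rightarrow> real \<Rightarrow> real" where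
  "ball_average f x \<rho> = (LINT y:ball x \<rho>|mu. f y) / measure mu (ball x \<rho>)"

definition local_Poincare :: "('a::compact_metric_measure_space l2 \<times> 'a l2) set \<Rightarrow> bool" where
  "local_Poincare L \<longleftrightarrow>
     (\<exists>C>0. \<exists>\<rho>0>0. \<forall>f\<in>smooth_domain L. \<forall>x \<rho>. 0 < \<rho> \<and> \<rho> < \<rho>0 \<longrightarrow>
        (LINT y:ball x \<rho>|mu. \<bar>rep_l2 f y - ball_average (rep_l2 f) x \<rho>\<bar>\<^sup>2)
          \<le> C * \<rho>\<^sup>2 * (LINT y:ball x \<rho>|mu. Gamma L f f y))"

definition heat_kernel ::
    "(real \<Rightarrow> 'a::compact_metric_measure_space l2 \<Rightarrow> 'a l2) \<Rightarrow> (real \<Rightarrow> 'a \<Rightarrow> 'a \<Rightarrow> real) \<Rightarrow> bool" where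
  "heat_kernel T P \<longleftrightarrow>
     (\<forall>t>0. (\<lambda>(x, y). P t x y) \<in> borel_measurable (mu \<Otimes>\<^sub>M mu) \<and>
        (\<forall>f. AE x in mu. integrable mu (\<lambda>y. P t x y * rep_l2 f y) \<and>
                         rep_l2 (T t f) x = (\<integral>y. P t x y * rep_l2 f y \<partial>mu)))"

definition Gaussian_estimates :: "(real \<Rightarrow> 'a::compact_metric_measure_space \<Rightarrow> 'a \<Rightarrow> real) \<Rightarrow> bool" where
  "Gaussian_estimates P \<longleftrightarrow>
     (\<exists>C1>0. \<exists>C2>0. \<exists>c1>0. \<exists>c2>0. \<forall>t x y. 0 < t \<and> t < 1 \<longrightarrow>
        C1 * exp (- (c1 * (dist x y)\<^sup>2 / t))
            / sqrt (measure mu (ball x (sqrt t)) * measure mu (ball y (sqrt t))) \<le> P t x y \<and>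
        P t x y \<le> C2 * exp (- (c2 * (dist x y)\<^sup>2 / t))
            / sqrt (measure mu (ball x (sqrt t)) * measure mu (ball y (sqrt t))))"

definition short_time_Gaussian_heat_kernel ::
    "('a::compact_metric_measure_space l2 \<times> 'a l2) set \<Rightarrow> bool" where
  "short_time_Gaussian_heat_kernel L \<longleftrightarrow>
     (\<exists>T P. heat_semigroup L T \<and> heat_kernel T P \<and> Gaussian_estimates P)"


section \<open>Metric lattices\<close>

definition metric_lattice :: "real \<Rightarrow> nat \<Rightarrow> 'a::metric_space set \<Rightarrow> bool" where
  "metric_lattice \<rho> N A \<longleftrightarrow>
     (\<forall>x\<in>A. \<forall>y\<in>A. x \<noteq> y \<longrightarrow> ball x (\<rho> / 2) \<inter> ball y (\<rho> / 2) = {}) \<and>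
     (\<Union>x\<in>A. ball x \<rho>) = UNIV \<and>
     (\<forall>y. finite {x\<in>A. y \<in> ball x \<rho>} \<and> card {x\<in>A. y \<in> ball x \<rho>} \<le> N)"

text \<open>Cardinality with values in \<open>[0, \<infinity>]\<close>, so that no supremum is taken over junk values.\<close>

definition ecard :: "'a set \<Rightarrow> ennreal" where
  "ecard A = emeasure (count_space UNIV) A"

end

theory Submission
  imports Defs "HOL-Real_Asymp.Real_Asymp"
begin

text \<open>
  Put \<open>\<rho> = \<omega>\<^bsup>-1/2\<^esup>\<close> and let \<open>\<phi>\<^sub>j\<close> be the normalized indicator of \<open>B(x\<^sub>j, \<rho>/2)\<close>, so that the
  \<open>\<phi>\<^sub>j\<close> are orthonormal.  For \<open>t = 4\<^sup>k \<rho>\<^sup>2\<close> the lower Gaussian estimate and doubling give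
  \<open>\<langle>e\<^bsup>-tL\<^esup> \<phi>\<^sub>j, \<phi>\<^sub>j\<rangle> \<ge> C\<^sub>1 e\<^bsup>-c\<^esup> q\<^bsup>-(k+2)\<^esup>\<close> with \<open>c = c\<^sub>1\<close> and \<open>q\<close> the doubling constant.  If \<open>E\<close> is an
  orthonormal basis of the eigenvectors with eigenvalue at most \<open>\<omega>\<close>, the same number is at most
  \<open>\<Sum>\<^sub>e\<^sub>\<in>\<^sub>E \<langle>\<phi>\<^sub>j, e\<rangle>\<^sup>2 + e\<^bsup>-t\<omega>\<^esup>\<close>, and \<open>t\<omega> = 4\<^sup>k\<close>.  Summing over \<open>j\<close>, Bessel's inequality bounds the
  double sum by \<open>card E\<close>, and for \<open>k\<close> large \<open>e\<^bsup>-4^k\<^esup>\<close> is smaller than the lower bound.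

  The upper Gaussian estimate makes the kernels of \<open>e\<^bsup>-tL\<^esup>\<close> bounded, hence the operators
  Hilbert--Schmidt and compact; this makes \<open>E\<close> finite and gives the decay \<open>e\<^bsup>-t\<omega>\<^esup>\<close> on the
  orthogonal complement of \<open>E\<close>.
\<close>

section \<open>Orthonormal families and Hilbert--Schmidt operators\<close>

definition orthonormal :: "'h::real_inner set \<Rightarrow> bool" where
  "orthonormal B \<longleftrightarrow> (\<forall>x\<in>B. \<forall>y\<in>B. inner x y = (if x = y then 1 else 0))"

definition orthogonal_proj :: "'h::real_inner set \<Rightarrow> 'h \<Rightarrow> 'h" where
  "orthogonal_proj B f = (\<Sum>e\<in>B. inner f e *\<^sub>R e)"

lemma orthonormal_empty: "orthonormal {}"
  by (simp add: orthonormal_def)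

lemma orthonormal_subset: "orthonormal B \<Longrightarrow> A \<subseteq> B \<Longrightarrow> orthonormal A"
  unfolding orthonormal_def by blast

lemma orthonormal_norm: "orthonormal B \<Longrightarrow> e \<in> B \<Longrightarrow> norm e = 1"
  by (simp add: orthonormal_def norm_eq_sqrt_inner)

lemma orthonormal_insert:
  assumes "orthonormal B" "norm f = 1" "\<And>e. e \<in> B \<Longrightarrow> inner f e = 0"
  shows "orthonormal (insert f B)"
proof -
  have "inner f f = 1"
    using assms(2) by (simp add: dot_square_norm)
  then show ?thesis
    using assms(1,3) by (auto simp: orthonormal_def inner_commute)
qed

lemma orthonormal_independent:
  assumes "orthonormal B" shows "independent B"
proof (rule pairwise_orthogonal_independent)
  show "pairwise orthogonal B"
    using assms by (auto simp: orthonormal_def pairwise_def orthogonal_def)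
  show "0 \<notin> B"
    using assms by (metis inner_zero_left orthonormal_def zero_neq_one)
qed

lemma inner_orthogonal_proj:
  assumes "finite B" "orthonormal B" "e \<in> B"
  shows "inner (orthogonal_proj B f) e = inner f e"
proof -
  have "inner (orthogonal_proj B f) e = (\<Sum>x\<in>B. if x = e then inner f x else 0)"
    unfolding orthogonal_proj_def inner_sum_left
    using assms by (intro sum.cong) (auto simp: orthonormal_def)
  then show ?thesis using assms by simp
qed

lemma inner_diff_orthogonal_proj:
  assumes "finite B" "orthonormal B" "e \<in> B"
  shows "inner (f - orthogonal_proj B f) e = 0"
  by (simp add: inner_diff_left inner_orthogonal_proj assms)

lemma norm_orthogonal_proj:
  assumes "finite B" "orthonormal B"
  shows "(norm (orthogonal_proj B f))\<^sup>2 = (\<Sum>e\<in>B. (inner f e)\<^sup>2)"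
proof -
  have "(norm (orthogonal_proj B f))\<^sup>2 = (\<Sum>e\<in>B. inner f e * inner (orthogonal_proj B f) e)"
    unfolding power2_norm_eq_inner
    by (subst (2) orthogonal_proj_def) (simp add: inner_sum_right)
  then show ?thesis
    by (simp add: inner_orthogonal_proj assms power2_eq_square)
qed

lemma Pythagoras_orthogonal_proj:
  assumes "finite B" "orthonormal B"
  shows "(norm f)\<^sup>2 = (norm (orthogonal_proj B f))\<^sup>2 + (norm (f - orthogonal_proj B f))\<^sup>2"
proof -
  have "inner (f - orthogonal_proj B f) (orthogonal_proj B f) = 0"
    by (subst (2) orthogonal_proj_def)
      (simp add: inner_sum_right inner_diff_orthogonal_proj assms)
  then show ?thesis
    using norm_add_Pythagorean[of "f - orthogonal_proj B f" "orthogonal_proj B f"]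
    by (simp add: orthogonal_def)
qed

lemma Bessel_inequality:
  assumes "finite B" "orthonormal B"
  shows "(\<Sum>e\<in>B. (inner f e)\<^sup>2) \<le> (norm f)\<^sup>2"
  using Pythagoras_orthogonal_proj[OF assms, of f] norm_orthogonal_proj[OF assms, of f]
  by simp

lemma finite_bounded_card_maximal:
  assumes "P {}" "\<And>B. finite B \<Longrightarrow> P B \<Longrightarrow> card B \<le> n"
  shows "\<exists>B. finite B \<and> P B \<and> (\<forall>x. x \<notin> B \<longrightarrow> \<not> P (insert x B))"
proof -
  let ?Q = "\<lambda>k. \<exists>B. finite B \<and> P B \<and> card B = k"
  have "?Q 0"
    using assms(1) by (intro exI[of _ "{}"]) auto
  moreover have "k \<le> n" if "?Q k" for k
    using that assms(2) by auto
  ultimately obtain k where k: "?Q k" "\<And>j. ?Q j \<Longrightarrow> j \<le> k"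
    using GreatestI_nat[of ?Q 0 n] Greatest_le_nat[of ?Q _ n] by blast
  from k(1) obtain B where B: "finite B" "P B" "card B = k" by blast
  have "\<not> P (insert x B)" if "x \<notin> B" for x
  proof -
    from that have "card (insert x B) = Suc k" using B by simp
    with k(2)[of "Suc k"] B(1) show ?thesis by fastforce
  qed
  with B show ?thesis by blast
qed

definition Hilbert_Schmidt :: "('h::real_inner \<Rightarrow> 'h) \<Rightarrow> real \<Rightarrow> bool" where
  "Hilbert_Schmidt K H \<longleftrightarrow>
     (\<forall>B. finite B \<and> orthonormal B \<longrightarrow> (\<Sum>e\<in>B. (norm (K e))\<^sup>2) \<le> H)"

lemma Hilbert_Schmidt_card_le:
  assumes K: "Hilbert_Schmidt K H" and B: "finite B" "orthonormal B"
    and d: "0 < d" "\<And>e. e \<in> B \<Longrightarrow> d \<le> norm (K e)"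
  shows "card B \<le> nat \<lfloor>H / d\<^sup>2\<rfloor>"
proof -
  have "real (card B) * d\<^sup>2 = (\<Sum>e\<in>B. d\<^sup>2)" by simp
  also have "\<dots> \<le> (\<Sum>e\<in>B. (norm (K e))\<^sup>2)"
    using d by (intro sum_mono power_mono) auto
  also have "\<dots> \<le> H" using K B by (simp add: Hilbert_Schmidt_def)
  finally have "real (card B) \<le> H / d\<^sup>2"
    using d(1) by (simp add: pos_le_divide_eq)
  then show ?thesis by (simp add: le_nat_floor)
qed

lemma compact_cube_combinations:
  assumes "finite B"
  shows "compact {\<Sum>e\<in>B. a e *\<^sub>R (v e :: 'h::real_normed_vector) | a. \<forall>e\<in>B. \<bar>a e\<bar> \<le> 1}"
  using assms
proof induction
  case empty
  then show ?case by simp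
next
  case (insert x B)
  let ?S = "\<lambda>B. {\<Sum>e\<in>B. a e *\<^sub>R (v e) | a. \<forall>e\<in>B. \<bar>a e\<bar> \<le> (1::real)}"
  let ?I = "(\<lambda>t. t *\<^sub>R v x) ` {-1..1}"
  have "compact ?I"
    by (intro compact_continuous_image continuous_intros) auto
  then have "compact {p + q | p q. p \<in> ?I \<and> q \<in> ?S B}"
    using insert.IH by (rule compact_sums)
  moreover have "{p + q | p q. p \<in> ?I \<and> q \<in> ?S B} = ?S (insert x B)"
  proof (intro set_eqI iffI)
    fix y assume "y \<in> {p + q | p q. p \<in> ?I \<and> q \<in> ?S B}"
    then obtain t a where y: "y = t *\<^sub>R v x + (\<Sum>e\<in>B. a e *\<^sub>R v e)"
      "t \<in> {-1..1}" "\<forall>e\<in>B. \<bar>a e\<bar> \<le> 1"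
      by blast
    have "(\<Sum>e\<in>B. (a(x := t)) e *\<^sub>R v e) = (\<Sum>e\<in>B. a e *\<^sub>R v e)"
      using insert.hyps by (intro sum.cong) auto
    then have "y = (\<Sum>e\<in>insert x B. (a(x := t)) e *\<^sub>R v e)"
      using insert.hyps y(1) by simp
    moreover have "\<forall>e\<in>insert x B. \<bar>(a(x := t)) e\<bar> \<le> 1"
      using y by auto
    ultimately show "y \<in> ?S (insert x B)" by blast
  next
    fix y assume "y \<in> ?S (insert x B)"
    then obtain a where a: "y = (\<Sum>e\<in>insert x B. a e *\<^sub>R v e)" "\<forall>e\<in>insert x B. \<bar>a e\<bar> \<le> 1"
      by blast
    have "y = a x *\<^sub>R v x + (\<Sum>e\<in>B. a e *\<^sub>R v e)"
      using insert.hyps a(1) by simp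
    moreover have "a x *\<^sub>R v x \<in> ?I" using a(2) by (auto simp: abs_le_iff)
    moreover have "(\<Sum>e\<in>B. a e *\<^sub>R v e) \<in> ?S B" using a(2) by blast
    ultimately show "y \<in> {p + q | p q. p \<in> ?I \<and> q \<in> ?S B}" by blast
  qed
  ultimately show ?case by simp
qed

lemma Hilbert_Schmidt_totally_bounded:
  assumes K: "bounded_linear K" "Hilbert_Schmidt K H"
  shows "Met_TC.mtotally_bounded (K ` cball (0 :: 'h::real_inner) 1)"
  unfolding Met_TC.mtotally_bounded_def
proof (intro allI impI)
  interpret K: bounded_linear K by fact
  fix \<epsilon> :: real assume \<epsilon>: "0 < \<epsilon>"
  let ?P = "\<lambda>B. orthonormal B \<and> (\<forall>e\<in>B. \<epsilon> / 4 \<le> norm (K e))"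
  have "\<exists>B. finite B \<and> ?P B \<and> (\<forall>x. x \<notin> B \<longrightarrow> \<not> ?P (insert x B))"
  proof (rule finite_bounded_card_maximal)
    show "card B \<le> nat \<lfloor>H / (\<epsilon> / 4)\<^sup>2\<rfloor>" if "finite B" "?P B" for B
      using that \<epsilon> by (intro Hilbert_Schmidt_card_le[OF K(2)]) auto
  qed (simp add: orthonormal_empty)
  then obtain B where B: "finite B" "?P B" and max: "\<And>x. x \<notin> B \<Longrightarrow> \<not> ?P (insert x B)"
    by blast
  note ob = B(1) B(2)[THEN conjunct1]
  have small: "norm (K g) \<le> \<epsilon> / 4 * norm g" if g: "\<And>e. e \<in> B \<Longrightarrow> inner g e = 0" for g
  proof (rule ccontr)
    assume *: "\<not> ?thesis"
    have "g \<noteq> 0" using * K.zero by auto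
    define u where "u = g /\<^sub>R norm g"
    have u: "norm u = 1" "\<And>e. e \<in> B \<Longrightarrow> inner u e = 0"
      using \<open>g \<noteq> 0\<close> g by (auto simp: u_def)
    have "norm (K u) = norm (K g) / norm g"
      by (simp add: u_def K.scaleR divide_inverse_commute)
    then have "\<epsilon> / 4 < norm (K u)"
      using * \<open>g \<noteq> 0\<close> by (simp add: pos_less_divide_eq)
    moreover have "u \<notin> B"
      using u by (metis inner_eq_zero_iff norm_zero zero_neq_one)
    moreover have "orthonormal (insert u B)"
      using orthonormal_insert[OF ob(2) u] .
    ultimately show False
      using max[of u] B(2) by auto
  qed
  define C where "C = {\<Sum>e\<in>B. a e *\<^sub>R K e | a. \<forall>e\<in>B. \<bar>a e\<bar> \<le> 1}"
  have "compact C"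
    unfolding C_def using B(1) by (rule compact_cube_combinations)
  then obtain F where F: "finite F" "C \<subseteq> (\<Union>x\<in>F. ball x (\<epsilon> / 4))"
    using \<epsilon> compact_eq_totally_bounded[of C] by (meson zero_less_divide_iff zero_less_numeral)
  have dense: "\<exists>x\<in>F. dist (K f) x < \<epsilon> / 2" if f: "norm f \<le> 1" for f
  proof -
    let ?p = "orthogonal_proj B f"
    have "\<bar>inner f e\<bar> \<le> 1" if "e \<in> B" for e
    proof -
      have "\<bar>inner f e\<bar> \<le> norm f * norm e" by (rule Cauchy_Schwarz_ineq2)
      then show ?thesis using f orthonormal_norm[OF ob(2) that] by simp
    qed
    moreover have "K ?p = (\<Sum>e\<in>B. inner f e *\<^sub>R K e)"
      by (simp add: orthogonal_proj_def K.sum K.scaleR)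
    ultimately have "K ?p \<in> C"
      unfolding C_def by blast
    then obtain x where x: "x \<in> F" "dist x (K ?p) < \<epsilon> / 4"
      using F(2) by auto
    have "norm (f - ?p) \<le> 1"
    proof -
      have "(norm (f - ?p))\<^sup>2 \<le> (norm f)\<^sup>2"
        using Pythagoras_orthogonal_proj[OF ob, of f] by simp
      then have "norm (f - ?p) \<le> norm f"
        using power2_le_imp_le by auto
      then show ?thesis using f by simp
    qed
    then have "\<epsilon> / 4 * norm (f - ?p) \<le> \<epsilon> / 4"
      using \<epsilon> by simp
    then have "norm (K (f - ?p)) \<le> \<epsilon> / 4"
      using small[OF inner_diff_orthogonal_proj[OF ob]] by (meson order_trans)
    then have "dist (K f) (K ?p) \<le> \<epsilon> / 4"
      by (simp add: dist_norm K.diff)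
    then have "dist (K f) x < \<epsilon> / 2"
      using dist_triangle[of "K f" x "K ?p"] x(2) by (simp add: dist_commute)
    then show ?thesis using x(1) by blast
  qed
  define pick where "pick x = (SOME f. f \<in> cball 0 1 \<and> dist (K f) x < \<epsilon> / 2)" for x
  define G where "G = (\<lambda>x. K (pick x)) ` {x\<in>F. \<exists>f\<in>cball 0 1. dist (K f) x < \<epsilon> / 2}"
  have pick: "pick x \<in> cball 0 1 \<and> dist (K (pick x)) x < \<epsilon> / 2"
    if "\<exists>f\<in>cball 0 1. dist (K f) x < \<epsilon> / 2" for x
    unfolding pick_def by (rule someI_ex) (use that in blast)
  have "K ` cball 0 1 \<subseteq> (\<Union>y\<in>G. ball y \<epsilon>)"
  proof
    fix y assume "y \<in> K ` cball 0 1"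
    then obtain f where f: "y = K f" "f \<in> cball 0 1" by blast
    then obtain x where x: "x \<in> F" "dist (K f) x < \<epsilon> / 2"
      using dense by auto
    have *: "\<exists>f\<in>cball 0 1. dist (K f) x < \<epsilon> / 2" using f x by blast
    have "dist (K (pick x)) (K f) < \<epsilon>"
      using dist_triangle_half_l[of "K (pick x)" x \<epsilon> "K f"] pick[OF *] x(2)
      by (simp add: dist_commute)
    moreover have "K (pick x) \<in> G" unfolding G_def using * x(1) by blast
    ultimately show "y \<in> (\<Union>y\<in>G. ball y \<epsilon>)" using f(1) by auto
  qed
  moreover have "finite G" unfolding G_def using F(1) by simp
  moreover have "G \<subseteq> K ` cball 0 1" unfolding G_def using pick by blast
  ultimately show "\<exists>G. finite G \<and> G \<subseteq> K ` cball 0 1 \<and> K ` cball 0 1 \<subseteq> (\<Union>x\<in>G. Met_TC.mball x \<epsilon>)"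
    by auto
qed

lemma Hilbert_Schmidt_Cauchy_subsequence:
  assumes "bounded_linear K" "Hilbert_Schmidt K H" "\<And>n. norm (f n :: 'h::real_inner) \<le> 1"
  obtains r where "strict_mono (r :: nat \<Rightarrow> nat)" "Cauchy (\<lambda>n. K (f (r n)))"
proof -
  have "range (\<lambda>n. K (f n)) \<subseteq> K ` cball 0 1"
    using assms(3) by auto
  then obtain r where "strict_mono r" "Cauchy ((\<lambda>n. K (f n)) \<circ> r)"
    using Hilbert_Schmidt_totally_bounded[OF assms(1,2)]
    unfolding Met_TC.mtotally_bounded_sequentially by auto
  then show thesis using that by (auto simp: o_def)
qed

lemma symmetric_compact_square_eigenvector:
  fixes K :: "'h::real_inner \<Rightarrow> 'h"
  assumes K: "bounded_linear K" and sym: "\<And>f g. inner (K f) g = inner f (K g)"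
    and compact: "\<And>f :: nat \<Rightarrow> 'h. (\<And>n. norm (f n) \<le> 1) \<Longrightarrow>
      \<exists>r l. strict_mono (r :: nat \<Rightarrow> nat) \<and> (\<lambda>n. K (K (f (r n)))) \<longlonglongrightarrow> l"
    and W: "subspace W" "closed W" "\<And>f. f \<in> W \<Longrightarrow> K f \<in> W"
    and a: "0 \<le> a" and f0: "f0 \<in> W" "a * norm f0 < norm (K f0)"
  obtains \<nu> g where "a < \<nu>" "g \<in> W" "g \<noteq> 0" "K (K g) = \<nu>\<^sup>2 *\<^sub>R g"
proof -
  interpret K: bounded_linear K by fact
  define U where "U = {norm (K f) | f. f \<in> W \<and> norm f = 1}"
  define \<nu> where "\<nu> = Sup U"
  have "bdd_above U"
  proof -
    obtain c where "\<And>f. norm (K f) \<le> norm f * c" using K.bounded by blast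
    then have "norm (K f) \<le> c" if "norm f = 1" for f
      using that by (metis mult_1)
    then have "u \<le> c" if "u \<in> U" for u
      using that unfolding U_def by blast
    then show ?thesis by (rule bdd_aboveI)
  qed
  have unit: "norm (K (f /\<^sub>R norm f)) = norm (K f) / norm f" for f
    by (simp add: K.scaleR divide_inverse_commute)
  have le: "norm (K f) \<le> \<nu> * norm f" if "f \<in> W" for f
  proof (cases "f = 0")
    case False
    then have "norm (K (f /\<^sub>R norm f)) \<in> U"
      unfolding U_def using that W(1)
      by (intro CollectI exI[of _ "f /\<^sub>R norm f"]) (auto simp: subspace_scale)
    then have "norm (K f) / norm f \<le> \<nu>"
      unfolding \<nu>_def unit[symmetric] using \<open>bdd_above U\<close> by (rule cSup_upper)
    then show ?thesis using False by (simp add: pos_divide_le_eq)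
  qed (simp add: K.zero)
  have "f0 \<noteq> 0" using f0(2) K.zero by auto
  then have "a < \<nu>"
    using f0 le[OF f0(1)] by (smt (verit) mult_right_mono norm_ge_zero)
  then have "\<nu> > 0" using a by simp
  have U_ne: "U \<noteq> {}"
    unfolding U_def using f0(1) W(1) \<open>f0 \<noteq> 0\<close>
    by (auto intro!: exI[of _ "f0 /\<^sub>R norm f0"] simp: subspace_scale)
  have "\<exists>f. f \<in> W \<and> norm f = 1 \<and> \<nu> - 1 / real (Suc n) < norm (K f)" for n
  proof -
    have "\<nu> - 1 / real (Suc n) < \<nu>" by simp
    then show ?thesis
      using less_cSup_iff[OF U_ne \<open>bdd_above U\<close>] unfolding \<nu>_def U_def by blast
  qed
  then obtain f where f: "\<And>n. f n \<in> W" "\<And>n. norm (f n) = 1"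
    "\<And>n. \<nu> - 1 / real (Suc n) < norm (K (f n))"
    by metis
  have Kf: "(\<lambda>n. norm (K (f n))) \<longlonglongrightarrow> \<nu>"
  proof (rule tendsto_sandwich[of "\<lambda>n. \<nu> - 1 / real (Suc n)" _ _ "\<lambda>_. \<nu>"])
    show "(\<lambda>n. \<nu> - 1 / real (Suc n)) \<longlonglongrightarrow> \<nu>"
      using tendsto_diff[OF tendsto_const LIMSEQ_inverse_real_of_nat]
      by (simp add: divide_inverse)
    show "\<forall>\<^sub>F n in sequentially. norm (K (f n)) \<le> \<nu>"
      using le[OF f(1)] f(2) by (intro always_eventually allI) (metis mult.right_neutral)
    show "\<forall>\<^sub>F n in sequentially. \<nu> - 1 / real (Suc n) \<le> norm (K (f n))"
      using f(3) by (intro always_eventually allI less_imp_le)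
  qed simp
  obtain r l where r: "strict_mono r" and l: "(\<lambda>n. K (K (f (r n)))) \<longlonglongrightarrow> l"
    using compact[of f] f(2) by auto
  have defect: "(norm (K (K f) - \<nu>\<^sup>2 *\<^sub>R f))\<^sup>2 \<le> 2 * \<nu>^4 - 2 * \<nu>\<^sup>2 * (norm (K f))\<^sup>2"
    if "f \<in> W" "norm f = 1" for f
  proof -
    have "norm (K (K f)) \<le> \<nu> * (\<nu> * norm f)"
      using le[OF W(3)[OF that(1)]] le[OF that(1)] \<open>\<nu> > 0\<close>
      by (meson mult_left_mono order_trans less_imp_le)
    then have "(norm (K (K f)))\<^sup>2 \<le> (\<nu>\<^sup>2)\<^sup>2"
      using that(2) by (intro power_mono) (auto simp: power2_eq_square)
    moreover have "inner (K (K f)) f = (norm (K f))\<^sup>2"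
      by (simp add: sym power2_norm_eq_inner)
    moreover have "(norm (K (K f) - \<nu>\<^sup>2 *\<^sub>R f))\<^sup>2
        = (norm (K (K f)))\<^sup>2 - 2 * \<nu>\<^sup>2 * inner (K (K f)) f + (\<nu>\<^sup>2)\<^sup>2 * (norm f)\<^sup>2"
      unfolding power2_norm_eq_inner
      by (simp add: inner_diff_left inner_diff_right inner_commute power2_eq_square)
    ultimately show ?thesis using that(2) by simp
  qed
  have "(\<lambda>n. K (K (f n)) - \<nu>\<^sup>2 *\<^sub>R f n) \<longlonglongrightarrow> 0"
  proof -
    have "(\<lambda>n. 2 * \<nu>^4 - 2 * \<nu>\<^sup>2 * (norm (K (f n)))\<^sup>2) \<longlonglongrightarrow> 2 * \<nu>^4 - 2 * \<nu>\<^sup>2 * \<nu>\<^sup>2"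
      by (intro tendsto_intros Kf)
    then have lim: "(\<lambda>n. 2 * \<nu>^4 - 2 * \<nu>\<^sup>2 * (norm (K (f n)))\<^sup>2) \<longlonglongrightarrow> 0"
      by (simp only: mult.assoc flip: power_add) simp
    have "(\<lambda>n. (norm (K (K (f n)) - \<nu>\<^sup>2 *\<^sub>R f n))\<^sup>2) \<longlonglongrightarrow> 0"
      by (rule tendsto_sandwich[OF _ _ tendsto_const lim])
        (auto intro!: always_eventually defect f)
    then have "(\<lambda>n. sqrt ((norm (K (K (f n)) - \<nu>\<^sup>2 *\<^sub>R f n))\<^sup>2)) \<longlonglongrightarrow> sqrt 0"
      by (rule tendsto_real_sqrt)
    then show ?thesis by (simp add: tendsto_norm_zero_iff)
  qed
  then have "(\<lambda>n. K (K (f (r n))) - \<nu>\<^sup>2 *\<^sub>R f (r n)) \<longlonglongrightarrow> 0"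
    using LIMSEQ_subseq_LIMSEQ[OF _ r] by (fastforce simp: o_def)
  then have "(\<lambda>n. K (K (f (r n))) - (K (K (f (r n))) - \<nu>\<^sup>2 *\<^sub>R f (r n))) \<longlonglongrightarrow> l - 0"
    by (intro tendsto_diff l)
  then have "(\<lambda>n. \<nu>\<^sup>2 *\<^sub>R f (r n)) \<longlonglongrightarrow> l" by simp
  then have "(\<lambda>n. (1 / \<nu>\<^sup>2) *\<^sub>R \<nu>\<^sup>2 *\<^sub>R f (r n)) \<longlonglongrightarrow> (1 / \<nu>\<^sup>2) *\<^sub>R l"
    by (intro tendsto_intros)
  then have g: "(\<lambda>n. f (r n)) \<longlonglongrightarrow> (1 / \<nu>\<^sup>2) *\<^sub>R l" (is "_ \<longlonglongrightarrow> ?g")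
    using \<open>\<nu> > 0\<close> by simp
  have "norm ?g = 1"
    by (rule LIMSEQ_unique[OF tendsto_norm[OF g]]) (simp only: f(2) tendsto_const)
  then have "?g \<noteq> 0" by (metis norm_zero zero_neq_one)
  moreover have "?g \<in> W"
    using closed_sequentially[OF W(2) _ g] f(1) by auto
  moreover have "K (K ?g) = l"
    using LIMSEQ_unique[OF l K.tendsto[OF K.tendsto[OF g]]] by simp
  moreover have "l = \<nu>\<^sup>2 *\<^sub>R ?g" using \<open>\<nu> > 0\<close> by simp
  ultimately show thesis
    using that[OF \<open>a < \<nu>\<close>, of ?g] by metis
qed

section \<open>Heat semigroups of self-adjoint operators\<close>

lemma self_adjoint_symmetric:
  assumes "self_adjoint_operator L" "(f, f') \<in> L" "(g, g') \<in> L"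
  shows "inner f' g = inner f g'"
proof -
  have "(g, g') \<in> adjoint_operator L"
    using assms by (simp add: self_adjoint_operator_def)
  then show ?thesis using assms(2) by (auto simp: adjoint_operator_def)
qed

lemma self_adjointI:
  assumes "self_adjoint_operator L" "\<And>g g'. (g, g') \<in> L \<Longrightarrow> inner g' f = inner g h"
  shows "(f, h) \<in> L"
proof -
  have "(f, h) \<in> adjoint_operator L"
    using assms(2) by (auto simp: adjoint_operator_def)
  then show ?thesis using assms(1) by (simp add: self_adjoint_operator_def)
qed

lemma subspace_eigenspace:
  assumes "self_adjoint_operator L" shows "subspace (eigenspace L \<kappa>)"
proof -
  have L: "subspace L"
    using assms by (simp add: self_adjoint_operator_def linear_operator_def)
  show ?thesis
    unfolding subspace_def
  proof (intro conjI ballI allI)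
    show "0 \<in> eigenspace L \<kappa>"
      using subspace_0[OF L] by (simp add: eigenspace_def zero_prod_def)
    show "f + g \<in> eigenspace L \<kappa>" if "f \<in> eigenspace L \<kappa>" "g \<in> eigenspace L \<kappa>" for f g
      using that subspace_add[OF L, of "(f, \<kappa> *\<^sub>R f)" "(g, \<kappa> *\<^sub>R g)"]
      by (simp add: eigenspace_def scaleR_add_right)
    show "c *\<^sub>R f \<in> eigenspace L \<kappa>" if "f \<in> eigenspace L \<kappa>" for c f
      using that subspace_scale[OF L, of "(f, \<kappa> *\<^sub>R f)" c]
      by (simp add: eigenspace_def mult.commute)
  qed
qed

lemma eigenspace_orthogonal:
  assumes "self_adjoint_operator L" "f \<in> eigenspace L \<kappa>" "g \<in> eigenspace L \<kappa>'" "\<kappa> \<noteq> \<kappa>'"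
  shows "inner f g = 0"
  using self_adjoint_symmetric[OF assms(1), of f "\<kappa> *\<^sub>R f" g "\<kappa>' *\<^sub>R g"] assms(2-)
  by (auto simp: eigenspace_def)

lemma eigenvalue_nonneg:
  assumes "nonneg_operator L" "f \<in> eigenspace L \<kappa>" "f \<noteq> 0"
  shows "0 \<le> \<kappa>"
proof -
  have "0 \<le> inner (\<kappa> *\<^sub>R f) f"
    using assms by (auto simp: nonneg_operator_def eigenspace_def)
  moreover have "0 < inner f f" using assms(3) by simp
  ultimately show ?thesis by (simp add: zero_le_mult_iff)
qed

lemma tendsto_at_rightI:
  fixes F :: "real \<Rightarrow> 'b::topological_space"
  assumes "((\<lambda>h. F (t + h)) \<longlongrightarrow> l) (at_right 0)"
  shows "(F \<longlongrightarrow> l) (at_right t)"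
  using assms by (subst filterlim_at_right_to_0) (simp add: add.commute)

lemma tendsto_at_leftI:
  fixes F :: "real \<Rightarrow> 'b::topological_space"
  assumes "((\<lambda>h. F (t - h)) \<longlongrightarrow> l) (at_right 0)"
  shows "(F \<longlongrightarrow> l) (at_left t)"
  using assms by (subst filterlim_at_left_to_right, subst filterlim_at_right_to_0) simp

locale locally_bounded_heat_semigroup =
  fixes L :: "('h::real_inner \<times> 'h) set" and T :: "real \<Rightarrow> 'h \<Rightarrow> 'h"
  assumes heat: "heat_semigroup L T"
    and self_adjoint: "self_adjoint_operator L"
    and nonneg: "nonneg_operator L"
    and bound: "\<And>a. 0 < a \<Longrightarrow> a < 1 \<Longrightarrow> \<exists>M. \<forall>t f. a \<le> t \<and> t < 1 \<longrightarrow> norm (T t f) \<le> M * norm f"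
begin

lemma bounded_linear_T: "0 \<le> t \<Longrightarrow> bounded_linear (T t)"
  using heat by (simp add: heat_semigroup_def)

lemma T_zero_time: "T 0 f = f"
  using heat by (simp add: heat_semigroup_def)

lemma T_add_time: "0 \<le> s \<Longrightarrow> 0 \<le> t \<Longrightarrow> T (s + t) f = T s (T t f)"
  using heat by (simp add: heat_semigroup_def)

lemma T_tendsto_0: "((\<lambda>h. T h f) \<longlongrightarrow> f) (at_right 0)"
  using heat by (simp add: heat_semigroup_def)

lemma mem_L_iff: "(f, g) \<in> L \<longleftrightarrow> ((\<lambda>h. (T h f - f) /\<^sub>R h) \<longlongrightarrow> - g) (at_right 0)"
proof -
  have "(f, - g) \<in> generator T \<longleftrightarrow> (f, g) \<in> L"
    using heat by (auto simp: heat_semigroup_def)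
  then show ?thesis by (simp add: generator_def)
qed

lemma T_tendsto_from_left:
  assumes t: "0 < t" "t < 1" and u: "(u \<longlongrightarrow> l) (at_right 0)"
  shows "((\<lambda>h. T (t - h) (u h)) \<longlongrightarrow> T t l) (at_right 0)"
proof -
  obtain M where M: "\<And>s f. t / 2 \<le> s \<Longrightarrow> s < 1 \<Longrightarrow> norm (T s f) \<le> M * norm f"
    using bound[of "t / 2"] t by auto
  have "((\<lambda>h. T (t - h) (u h) - T t l) \<longlongrightarrow> 0) (at_right 0)"
  proof (rule Lim_null_comparison)
    have "((\<lambda>h. M * norm (u h - T h l)) \<longlongrightarrow> M * norm (l - l)) (at_right 0)"
      by (intro tendsto_intros u T_tendsto_0)
    then show "((\<lambda>h. M * norm (u h - T h l)) \<longlongrightarrow> 0) (at_right 0)" by simp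
    have "\<forall>\<^sub>F h in at_right 0. h \<in> {0<..<t / 2}"
      using t by (intro eventually_at_rightI[of 0 "t / 2"]) auto
    then show "\<forall>\<^sub>F h in at_right 0. norm (T (t - h) (u h) - T t l) \<le> M * norm (u h - T h l)"
    proof eventually_elim
      case (elim h)
      interpret bounded_linear "T (t - h)" using elim by (intro bounded_linear_T) auto
      have "T t l = T (t - h) (T h l)"
        using T_add_time[of "t - h" h l] elim by simp
      then have "T (t - h) (u h) - T t l = T (t - h) (u h - T h l)"
        by (simp add: diff)
      then show ?case using M[of "t - h"] elim t by simp
    qed
  qed
  then show ?thesis by (simp add: LIM_zero_iff)
qed

lemma T_tendsto_from_right:
  assumes "0 \<le> t" "(u \<longlongrightarrow> l) (at_right 0)"
  shows "((\<lambda>h. T t (u h)) \<longlongrightarrow> T t l) (at_right 0)"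
  using bounded_linear.tendsto[OF bounded_linear_T[OF assms(1)] assms(2)] .

lemma T_right_continuous:
  assumes "0 \<le> t" shows "((\<lambda>s. T s f) \<longlongrightarrow> T t f) (at_right t)"
proof (rule tendsto_at_rightI)
  have "((\<lambda>h. T t (T h f)) \<longlongrightarrow> T t f) (at_right 0)"
    by (intro T_tendsto_from_right assms T_tendsto_0)
  then show "((\<lambda>h. T (t + h) f) \<longlongrightarrow> T t f) (at_right 0)"
    by (rule Lim_transform_eventually)
      (use eventually_at_right_less[of 0] in eventually_elim, simp add: T_add_time assms)
qed

lemma T_isCont:
  assumes "0 < t" "t < 1" shows "isCont (\<lambda>s. T s f) t"
  unfolding isCont_def
  using T_right_continuous[of t f] tendsto_at_leftI[OF T_tendsto_from_left[OF assms tendsto_const]]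
    assms by (intro filterlim_split_at) auto

lemma T_continuous_on: "continuous_on {0..<1} (\<lambda>s. T s f)"
  unfolding continuous_on_def
proof
  fix t :: real assume t: "t \<in> {0..<1}"
  show "((\<lambda>s. T s f) \<longlongrightarrow> T t f) (at t within {0..<1})"
  proof (cases "t = 0")
    case True
    have "at (0::real) within {0..<1} = at_right 0"
      by (rule at_within_nhd[of _ "{-1<..<1}"]) auto
    then show ?thesis using True T_right_continuous[of 0] by simp
  next
    case False
    then have "isCont (\<lambda>s. T s f) t" using t by (intro T_isCont) auto
    then show ?thesis
      unfolding isCont_def by (rule tendsto_within_subset) simp
  qed
qed

lemma T_mem_L:
  assumes "0 \<le> t" "(f, g) \<in> L" shows "(T t f, T t g) \<in> L"
proof -
  interpret bounded_linear "T t" using assms by (simp add: bounded_linear_T)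
  have "((\<lambda>h. T t ((T h f - f) /\<^sub>R h)) \<longlongrightarrow> T t (- g)) (at_right 0)"
    using assms mem_L_iff by (intro T_tendsto_from_right) auto
  then have "((\<lambda>h. (T h (T t f) - T t f) /\<^sub>R h) \<longlongrightarrow> T t (- g)) (at_right 0)"
  proof (rule Lim_transform_eventually)
    show "\<forall>\<^sub>F h in at_right 0. T t ((T h f - f) /\<^sub>R h) = (T h (T t f) - T t f) /\<^sub>R h"
      using eventually_at_right_less[of 0]
    proof eventually_elim
      case (elim h)
      have "T t (T h f) = T h (T t f)"
        using T_add_time[of t h f] T_add_time[of h t f] elim assms(1) by (simp add: add.commute)
      then show ?case by (simp add: scaleR diff)
    qed
  qed
  then show ?thesis by (simp add: mem_L_iff neg)
qed

lemma T_has_vector_derivative: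
  assumes t: "0 < t" "t < 1" and fg: "(f, g) \<in> L"
  shows "((\<lambda>s. T s f) has_vector_derivative - T t g) (at t)"
proof -
  interpret bounded_linear "T t" using t by (simp add: bounded_linear_T)
  note lim = mem_L_iff[THEN iffD1, OF fg]
  have "((\<lambda>h. T t ((T h f - f) /\<^sub>R h)) \<longlongrightarrow> T t (- g)) (at_right 0)"
    using t by (intro T_tendsto_from_right lim) auto
  then have right: "((\<lambda>h. (T (t + h) f - T t f) /\<^sub>R h) \<longlongrightarrow> - T t g) (at_right 0)"
    unfolding neg
    by (rule Lim_transform_eventually)
      (use eventually_at_right_less[of 0] in eventually_elim, use t in \<open>simp add: T_add_time scaleR diff\<close>)
  have "((\<lambda>h. T (t - h) ((T h f - f) /\<^sub>R h)) \<longlongrightarrow> T t (- g)) (at_right 0)"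
    using T_tendsto_from_left[OF t lim] .
  then have "((\<lambda>h. (T (t - h) f - T t f) /\<^sub>R (- h)) \<longlongrightarrow> - T t g) (at_right 0)"
    unfolding neg
  proof (rule Lim_transform_eventually)
    have "\<forall>\<^sub>F h in at_right 0. h \<in> {0<..<t}"
      using t by (intro eventually_at_rightI[of 0 t]) auto
    then show "\<forall>\<^sub>F h in at_right 0.
        T (t - h) ((T h f - f) /\<^sub>R h) = (T (t - h) f - T t f) /\<^sub>R (- h)"
    proof eventually_elim
      case (elim h)
      interpret S: bounded_linear "T (t - h)" using elim by (intro bounded_linear_T) auto
      have "T t f = T (t - h) (T h f)"
        using T_add_time[of "t - h" h f] elim by simp
      then show ?case by (simp add: S.scaleR S.diff scaleR_diff_right)
    qed
  qed
  then have left: "((\<lambda>h. (T (t + h) f - T t f) /\<^sub>R h) \<longlongrightarrow> - T t g) (at_left 0)"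
    by (intro tendsto_at_leftI) simp
  have "((\<lambda>h. (T (t + h) f - T t f) /\<^sub>R h) \<longlongrightarrow> - T t g) (at 0)"
    using left right by (rule filterlim_split_at)
  then have "((\<lambda>h. norm ((T (t + h) f - T t f) /\<^sub>R h - (- T t g))) \<longlongrightarrow> 0) (at 0)"
    by (rule tendsto_norm_zero[OF LIM_zero])
  then have "((\<lambda>h. norm (T (t + h) f - T t f - h *\<^sub>R (- T t g)) / norm h) \<longlongrightarrow> 0) (at 0)"
  proof (rule Lim_transform_eventually)
    have "\<forall>\<^sub>F h::real in at 0. h \<noteq> 0" by (simp add: eventually_at_filter)
    then show "\<forall>\<^sub>F h in at 0. norm ((T (t + h) f - T t f) /\<^sub>R h - (- T t g))
        = norm (T (t + h) f - T t f - h *\<^sub>R (- T t g)) / norm h"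
    proof eventually_elim
      case (elim h)
      then have "(T (t + h) f - T t f) /\<^sub>R h - (- T t g)
          = (T (t + h) f - T t f - h *\<^sub>R (- T t g)) /\<^sub>R h"
        by (simp add: scaleR_diff_right scaleR_add_right)
      then show ?case by (simp only: norm_scaleR norm_inverse real_norm_def divide_inverse_commute abs_inverse)
    qed
  qed
  then show ?thesis
    unfolding has_vector_derivative_def has_derivative_at
    using bounded_linear_scaleR_left by blast
qed

lemma T_symmetric_on_domain:
  assumes t: "0 < t" "t < 1" and fg: "(f, f') \<in> L" "(g, g') \<in> L"
  shows "inner (T t f) g = inner f (T t g)"
proof -
  let ?\<psi> = "\<lambda>s. inner (T s f) (T (t - s) g)"
  have "?\<psi> t = ?\<psi> 0"
  proof (rule DERIV_isconst_end[where f = ?\<psi>])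
    have "continuous_on {0..t} (\<lambda>s. T s f)"
      using T_continuous_on by (rule continuous_on_subset) (use t in auto)
    moreover have "continuous_on {0..t} (\<lambda>s. T (t - s) g)"
      by (rule continuous_on_compose2[OF T_continuous_on[of g]]) (use t in \<open>auto intro!: continuous_intros\<close>)
    ultimately show "continuous_on {0..t} ?\<psi>" by (intro continuous_intros)
    fix s assume s: "0 < s" "s < t"
    have "((\<lambda>s. T s f) has_vector_derivative - T s f') (at s)"
      using s t fg by (intro T_has_vector_derivative) auto
    moreover have "((\<lambda>s. T (t - s) g) has_vector_derivative (-1) *\<^sub>R (- T (t - s) g')) (at s)"
    proof -
      have "((\<lambda>s. t - s) has_vector_derivative -1) (at s)"
        by (auto intro!: derivative_eq_intros)
      moreover have "((\<lambda>s. T s g) has_vector_derivative - T (t - s) g') (at (t - s))"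
        using s t fg by (intro T_has_vector_derivative) auto
      ultimately show ?thesis
        using vector_diff_chain_at[of "\<lambda>s. t - s" "-1" s "\<lambda>s. T s g" "- T (t - s) g'"]
          by (simp add: o_def)
    qed
    ultimately have "(?\<psi> has_vector_derivative
        inner (T s f) ((-1) *\<^sub>R (- T (t - s) g')) + inner (- T s f') (T (t - s) g)) (at s)"
      by (rule bounded_bilinear.has_vector_derivative[OF bounded_bilinear_inner])
    moreover have "inner (T s f') (T (t - s) g) = inner (T s f) (T (t - s) g')"
      using s t fg by (intro self_adjoint_symmetric[OF self_adjoint] T_mem_L) auto
    ultimately show "DERIV ?\<psi> s :> 0"
      by (simp add: has_real_derivative_iff_has_vector_derivative)
  qed (use t in auto)
  then show ?thesis by (simp add: T_zero_time)
qed

lemma T_symmetric: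
  assumes t: "0 < t" "t < 1"
  shows "inner (T t f) g = inner f (T t g)"
proof -
  have dense: "closure (Domain L) = UNIV"
    using self_adjoint by (simp add: self_adjoint_operator_def densely_defined_def)
  have cont: "continuous_on UNIV (T t)"
    using t by (intro linear_continuous_on bounded_linear_T) auto
  have "closed {f. inner (T t f) g = inner f (T t g)}" for g
    by (intro closed_Collect_eq continuous_intros cont)
  moreover have "Domain L \<subseteq> {f. inner (T t f) g = inner f (T t g)}" if "g \<in> Domain L" for g
    using that T_symmetric_on_domain[OF t] by auto
  ultimately have "closure (Domain L) \<subseteq> {f. inner (T t f) g = inner f (T t g)}" if "g \<in> Domain L" for g
    using that by (intro closure_minimal) auto
  then have "Domain L \<subseteq> {g. inner (T t f) g = inner f (T t g)}" for f
    using dense by auto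
  moreover have "closed {g. inner (T t f) g = inner f (T t g)}" for f
    by (intro closed_Collect_eq continuous_intros cont)
  ultimately have "closure (Domain L) \<subseteq> {g. inner (T t f) g = inner f (T t g)}" for f
    by (intro closure_minimal) auto
  then show ?thesis using dense by auto
qed

lemma inner_T_T:
  assumes "0 < t" "t < 1"
  shows "inner (T (t + t) f) f = (norm (T t f))\<^sup>2"
  using T_add_time[of t t f] T_symmetric[OF assms, of "T t f" f] assms
  by (simp only: power2_norm_eq_inner less_imp_le)

lemma T_eigenvector:
  assumes f: "f \<in> eigenspace L \<kappa>" and t: "0 < t" "t < 1"
  shows "T t f = exp (- \<kappa> * t) *\<^sub>R f"
proof -
  have "inner (T t f) g = inner (exp (- \<kappa> * t) *\<^sub>R f) g" for g
  proof -
    let ?\<psi> = "\<lambda>s. exp (\<kappa> * s) * inner (T s f) g"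
    have "?\<psi> t = ?\<psi> 0"
    proof (rule DERIV_isconst_end[where f = ?\<psi>])
      have "continuous_on {0..t} (\<lambda>s. T s f)"
        using T_continuous_on by (rule continuous_on_subset) (use t in auto)
      then show "continuous_on {0..t} ?\<psi>" by (intro continuous_intros)
      fix s assume s: "0 < s" "s < t"
      interpret bounded_linear "T s" using s by (intro bounded_linear_T) auto
      have "((\<lambda>s. T s f) has_vector_derivative - T s (\<kappa> *\<^sub>R f)) (at s)"
        using s t f by (intro T_has_vector_derivative) (auto simp: eigenspace_def)
      then have "((\<lambda>s. inner (T s f) g) has_vector_derivative inner (- T s (\<kappa> *\<^sub>R f)) g) (at s)"
        by (rule bounded_linear.has_vector_derivative[OF bounded_linear_inner_left])
      then have "DERIV (\<lambda>s. inner (T s f) g) s :> - \<kappa> * inner (T s f) g"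
        by (simp add: has_real_derivative_iff_has_vector_derivative scaleR)
      then show "DERIV ?\<psi> s :> 0"
        by (auto intro!: derivative_eq_intros)
    qed (use t in auto)
    then show ?thesis
      by (simp add: T_zero_time exp_minus field_simps)
  qed
  then show ?thesis
    using vector_eq_rdot by blast
qed

text \<open>If \<open>h = T\<^bsub>s/2\<^esub> f - \<nu> f\<close> with \<open>\<nu> > 0\<close> and \<open>T\<^bsub>s\<^esub> f = \<nu>\<^sup>2 f\<close>, then \<open>T\<^bsub>s/2\<^esub> h = - \<nu> h\<close>,
  which positivity of \<open>T\<^bsub>s/2\<^esub>\<close> allows only for \<open>h = 0\<close>.\<close>

lemma T_eigenvector_half:
  assumes s: "0 < s" "s < 2" and f: "T s f = exp (- \<kappa> * s) *\<^sub>R f"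
  shows "T (s / 2) f = exp (- \<kappa> * (s / 2)) *\<^sub>R f"
proof -
  let ?\<nu> = "exp (- \<kappa> * (s / 2))"
  interpret bounded_linear "T (s / 2)" using s by (intro bounded_linear_T) auto
  define h where "h = T (s / 2) f - ?\<nu> *\<^sub>R f"
  have "T (s / 2) (T (s / 2) f) = (?\<nu> * ?\<nu>) *\<^sub>R f"
    using T_add_time[of "s / 2" "s / 2" f] s f by (simp flip: exp_add)
  then have "T (s / 2) h = - ?\<nu> *\<^sub>R h"
    by (simp add: h_def diff scaleR algebra_simps)
  then have "- ?\<nu> * inner h h = (norm (T (s / 4) h))\<^sup>2"
    using inner_T_T[of "s / 4" h] s by simp
  moreover have "0 \<le> ?\<nu> * inner h h" by simp
  ultimately have "?\<nu> * inner h h = 0"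
    by (smt (verit) zero_le_power2 mult_minus_left)
  then have "h = 0" by simp
  then show ?thesis by (simp add: h_def)
qed

lemma eigenvector_T:
  assumes s: "0 < s" "s < 2" and f: "T s f = exp (- \<kappa> * s) *\<^sub>R f"
  shows "f \<in> eigenspace L \<kappa>"
proof -
  define h where "h n = s / 2 ^ n" for n :: nat
  have h: "0 < h n" "h n < 2" for n
  proof -
    have "h n \<le> s" using s by (simp add: h_def divide_le_eq mult_le_cancel_left1)
    then show "0 < h n" "h n < 2" using s by (auto simp: h_def)
  qed
  have Tf: "T (h n) f = exp (- \<kappa> * h n) *\<^sub>R f" for n
  proof (induction n)
    case 0
    then show ?case using f by (simp add: h_def)
  next
    case (Suc n)
    have "h (Suc n) = h n / 2" by (simp add: h_def)
    then show ?case using T_eigenvector_half[OF h Suc] by (simp only:)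
  qed
  have "h \<longlonglongrightarrow> 0"
  proof -
    have "(\<lambda>n. s * (1 / 2) ^ n) \<longlonglongrightarrow> s * 0"
      by (intro tendsto_intros LIMSEQ_realpow_zero) auto
    then show ?thesis by (simp add: h_def[abs_def] power_divide)
  qed
  then have h_lim: "filterlim h (at_right 0) sequentially"
    using h(1) by (auto simp: filterlim_at less_imp_neq[symmetric] intro!: always_eventually)
  have exp_lim: "((\<lambda>h. (exp (- \<kappa> * h) - 1) / h) \<longlongrightarrow> - \<kappa>) (at_right 0)"
  proof -
    have "DERIV (\<lambda>h. exp (- \<kappa> * h)) 0 :> - \<kappa>"
      by (auto intro!: derivative_eq_intros)
    then have "((\<lambda>h. (exp (- \<kappa> * h) - 1) / h) \<longlongrightarrow> - \<kappa>) (at 0)"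
      by (simp add: DERIV_def)
    then show ?thesis by (rule tendsto_within_subset) simp
  qed
  have "(f, \<kappa> *\<^sub>R f) \<in> L"
  proof (rule self_adjointI[OF self_adjoint])
    fix g g' assume g: "(g, g') \<in> L"
    have "(\<lambda>n. inner ((T (h n) g - g) /\<^sub>R h n) f) \<longlonglongrightarrow> inner (- g') f"
      by (intro tendsto_intros filterlim_compose[OF mem_L_iff[THEN iffD1, OF g] h_lim])
    moreover have "inner ((T (h n) g - g) /\<^sub>R h n) f = (exp (- \<kappa> * h n) - 1) / h n * inner g f" if "n > 0" for n
    proof -
      have "h n \<le> s / 2"
        using that s power_increasing[of 1 n "2::real"]
        by (simp add: h_def divide_le_eq le_divide_eq frac_le)
      then have "inner (T (h n) g) f = inner g (T (h n) f)"
        using h[of n] s by (intro T_symmetric) auto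
      then show ?thesis by (simp add: Tf inner_diff_left divide_inverse algebra_simps)
    qed
    then have "\<forall>\<^sub>F n in sequentially. inner ((T (h n) g - g) /\<^sub>R h n) f = (exp (- \<kappa> * h n) - 1) / h n * inner g f"
      by (intro eventually_sequentiallyI[of 1]) auto
    moreover have "(\<lambda>n. (exp (- \<kappa> * h n) - 1) / h n * inner g f) \<longlonglongrightarrow> - \<kappa> * inner g f"
      by (intro tendsto_intros filterlim_compose[OF exp_lim h_lim])
    ultimately have "inner (- g') f = - \<kappa> * inner g f"
      by (intro LIMSEQ_unique[OF Lim_transform_eventually])
    then show "inner g' f = inner g (\<kappa> *\<^sub>R f)" by simp
  qed
  then show ?thesis by (simp add: eigenspace_def)
qed

definition spectral_basis :: "real \<Rightarrow> 'h set \<Rightarrow> bool" where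
  "spectral_basis \<omega> B \<longleftrightarrow> finite B \<and> orthonormal B \<and> (\<forall>e\<in>B. \<exists>\<kappa>\<le>\<omega>. e \<in> eigenspace L \<kappa>) \<and>
     (\<forall>\<kappa> f. \<kappa> \<le> \<omega> \<and> f \<in> eigenspace L \<kappa> \<and> (\<forall>e\<in>B. inner f e = 0) \<longrightarrow> f = 0)"

lemma spectral_basis_exists:
  assumes s: "0 < s" "s < 1" and HS: "Hilbert_Schmidt (T s) H"
  obtains B where "spectral_basis \<omega> B"
proof -
  let ?P = "\<lambda>B. orthonormal B \<and> (\<forall>e\<in>B. \<exists>\<kappa>\<le>\<omega>. e \<in> eigenspace L \<kappa>)"
  have empty: "?P {}" using orthonormal_empty by auto
  have card: "card B \<le> nat \<lfloor>H / (exp (- \<omega> * s))\<^sup>2\<rfloor>" if B: "finite B" "?P B" for B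
  proof -
    have "exp (- \<omega> * s) \<le> norm (T s e)" if e: "e \<in> B" for e
    proof -
      obtain \<kappa> where \<kappa>: "\<kappa> \<le> \<omega>" "e \<in> eigenspace L \<kappa>" using bspec[OF conjunct2[OF B(2)] e] by blast
      have "norm e = 1" by (rule orthonormal_norm[OF conjunct1[OF B(2)] e])
      then have "norm (T s e) = exp (- \<kappa> * s)"
        using T_eigenvector[OF \<kappa>(2) s] by simp
      then show ?thesis using \<kappa>(1) s(1) by simp
    qed
    then show ?thesis
      by (rule Hilbert_Schmidt_card_le[OF HS B(1) conjunct1[OF B(2)] exp_gt_zero])
  qed
  obtain B where B: "finite B" "?P B" and max: "\<And>x. x \<notin> B \<Longrightarrow> \<not> ?P (insert x B)"
    using finite_bounded_card_maximal[of ?P, OF empty card] by blast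
  have "f = 0" if f: "\<kappa> \<le> \<omega>" "f \<in> eigenspace L \<kappa>" "\<forall>e\<in>B. inner f e = 0" for \<kappa> f
  proof (rule ccontr)
    assume "f \<noteq> 0"
    define u where "u = f /\<^sub>R norm f"
    have u: "norm u = 1" "\<And>e. e \<in> B \<Longrightarrow> inner u e = 0"
      using \<open>f \<noteq> 0\<close> f by (auto simp: u_def)
    have "u \<in> eigenspace L \<kappa>"
      unfolding u_def using f(2) by (intro subspace_scale subspace_eigenspace self_adjoint)
    moreover have "u \<notin> B" using u by (metis inner_eq_zero_iff norm_zero zero_neq_one)
    ultimately show False
      using max[of u] orthonormal_insert[OF _ u] B(2) f(1) by auto
  qed
  then have "spectral_basis \<omega> B"
    unfolding spectral_basis_def using B by blast
  then show thesis by (rule that)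
qed

lemma card_spectral_basis:
  assumes "spectral_basis \<omega> B"
  shows "card B = eigenvalue_count L \<omega>"
proof -
  have B: "finite B" "orthonormal B"
    and max: "\<And>\<kappa> f. \<kappa> \<le> \<omega> \<Longrightarrow> f \<in> eigenspace L \<kappa> \<Longrightarrow> \<forall>e\<in>B. inner f e = 0 \<Longrightarrow> f = 0"
    using assms unfolding spectral_basis_def by blast+
  obtain k where k: "\<And>e. e \<in> B \<Longrightarrow> k e \<le> \<omega>" "\<And>e. e \<in> B \<Longrightarrow> e \<in> eigenspace L (k e)"
    using assms unfolding spectral_basis_def by metis
  let ?B = "\<lambda>\<kappa>. {e \<in> B. k e = \<kappa>}"
  have nz: "e \<noteq> 0" if "e \<in> B" for e
    using orthonormal_norm[OF B(2) that] by auto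
  have span: "eigenspace L \<kappa> \<subseteq> span (?B \<kappa>)" if \<kappa>: "\<kappa> \<le> \<omega>" for \<kappa>
  proof
    fix f assume f: "f \<in> eigenspace L \<kappa>"
    let ?p = "orthogonal_proj (?B \<kappa>) f"
    have ob: "finite (?B \<kappa>)" "orthonormal (?B \<kappa>)"
      using B orthonormal_subset[OF B(2)] by auto
    have p: "?p \<in> span (?B \<kappa>)"
      unfolding orthogonal_proj_def by (intro span_sum span_scale span_base)
    have "span (?B \<kappa>) \<subseteq> eigenspace L \<kappa>"
      using k(2) by (intro span_minimal subspace_eigenspace self_adjoint) auto
    then have r: "f - ?p \<in> eigenspace L \<kappa>"
      using p f by (intro subspace_diff subspace_eigenspace self_adjoint) auto
    have "inner (f - ?p) e = 0" if "e \<in> B" for e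
    proof (cases "k e = \<kappa>")
      case True
      then show ?thesis using that by (intro inner_diff_orthogonal_proj ob) auto
    next
      case False
      then show ?thesis using eigenspace_orthogonal[OF self_adjoint r k(2)[OF that]] by auto
    qed
    then have "f - ?p = 0" using max[OF \<kappa> r] by blast
    then show "f \<in> span (?B \<kappa>)" using p by simp
  qed
  have dim: "dim (eigenspace L \<kappa>) = card (?B \<kappa>)" if "\<kappa> \<le> \<omega>" for \<kappa>
    using span[OF that] k(2) orthonormal_subset[OF B(2)]
    by (intro dim_unique[of "?B \<kappa>"] orthonormal_independent) auto
  have "{\<kappa>. 0 \<le> \<kappa> \<and> \<kappa> \<le> \<omega> \<and> eigenspace L \<kappa> \<noteq> {0}} = k ` B"
  proof (intro set_eqI iffI)
    fix \<kappa> assume "\<kappa> \<in> {\<kappa>. 0 \<le> \<kappa> \<and> \<kappa> \<le> \<omega> \<and> eigenspace L \<kappa> \<noteq> {0}}"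
    then have \<kappa>: "\<kappa> \<le> \<omega>" "eigenspace L \<kappa> \<noteq> {0}" by auto
    have "?B \<kappa> \<noteq> {}"
    proof
      assume "?B \<kappa> = {}"
      then have "eigenspace L \<kappa> \<subseteq> {0}" using span[OF \<kappa>(1)] by (metis span_empty)
      moreover have "0 \<in> eigenspace L \<kappa>" using subspace_0 subspace_eigenspace self_adjoint by blast
      ultimately show False using \<kappa>(2) by blast
    qed
    then show "\<kappa> \<in> k ` B" by blast
  next
    fix \<kappa> assume "\<kappa> \<in> k ` B"
    then obtain e where "e \<in> B" "\<kappa> = k e" by blast
    then show "\<kappa> \<in> {\<kappa>. 0 \<le> \<kappa> \<and> \<kappa> \<le> \<omega> \<and> eigenspace L \<kappa> \<noteq> {0}}"
      using k[of e] nz[of e] eigenvalue_nonneg[OF nonneg, of e] by auto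
  qed
  then have "eigenvalue_count L \<omega> = (\<Sum>\<kappa>\<in>k ` B. card (?B \<kappa>))"
    unfolding eigenvalue_count_def by (intro sum.cong) (auto simp: dim k(1))
  also have "\<dots> = card B"
    using sum.image_gen[OF B(1), of "\<lambda>_. 1::nat" k] by simp
  finally show ?thesis ..
qed

lemma T_decay:
  assumes s: "0 < s" "s < 1" and B: "spectral_basis \<omega> B"
    and compact: "\<And>f :: nat \<Rightarrow> 'h. (\<And>n. norm (f n) \<le> 1) \<Longrightarrow>
      \<exists>r l. strict_mono (r :: nat \<Rightarrow> nat) \<and> (\<lambda>n. T s (T s (f (r n)))) \<longlonglongrightarrow> l"
    and f: "\<And>e. e \<in> B \<Longrightarrow> inner f e = 0"
  shows "norm (T s f) \<le> exp (- \<omega> * s) * norm f"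
proof (rule ccontr)
  assume *: "\<not> ?thesis"
  define W where "W = {f. \<forall>e\<in>B. inner f e = 0}"
  have "subspace W"
    by (auto simp: W_def subspace_def inner_add_left)
  moreover have "closed W"
  proof -
    have "W = (\<Inter>e\<in>B. {f. inner f e = 0})" by (auto simp: W_def)
    then show ?thesis by (auto intro!: closed_INT closed_Collect_eq continuous_intros)
  qed
  moreover have "T s f \<in> W" if "f \<in> W" for f
    unfolding W_def
  proof (intro CollectI ballI)
    fix e assume e: "e \<in> B"
    then obtain \<kappa> where "e \<in> eigenspace L \<kappa>"
      using B by (auto simp: spectral_basis_def)
    then have "T s e = exp (- \<kappa> * s) *\<^sub>R e" using T_eigenvector s by blast
    then show "inner (T s f) e = 0" using that e by (simp add: T_symmetric s W_def)
  qed
  moreover have "f \<in> W" using f by (simp add: W_def)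
  moreover have "bounded_linear (T s)" using s by (intro bounded_linear_T) auto
  moreover have "exp (- \<omega> * s) * norm f < norm (T s f)" using * by (simp only: not_le)
  ultimately obtain \<nu> g where g: "exp (- \<omega> * s) < \<nu>" "g \<in> W" "g \<noteq> 0" "T s (T s g) = \<nu>\<^sup>2 *\<^sub>R g"
    using symmetric_compact_square_eigenvector[of "T s" W "exp (- \<omega> * s)" f]
      T_symmetric[OF s] compact exp_ge_zero by blast
  have "0 < \<nu>" using g(1) exp_gt_zero[of "- \<omega> * s"] by linarith
  define \<kappa> where "\<kappa> = - ln \<nu> / s"
  have "\<nu> = exp (- \<kappa> * s)" using \<open>0 < \<nu>\<close> s by (simp add: \<kappa>_def)
  then have "\<nu>\<^sup>2 = exp (- \<kappa> * (s + s))" and "\<kappa> < \<omega>"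
    using g(1) s by (auto simp: power2_eq_square algebra_simps simp flip: exp_add)
  then have "g \<in> eigenspace L \<kappa>"
    using g(4) s T_add_time[of s s g] by (intro eigenvector_T[of "s + s"]) auto
  moreover have "\<forall>e\<in>B. inner g e = 0" using g(2) by (simp add: W_def)
  moreover have "f = 0" if "\<kappa> \<le> \<omega>" "f \<in> eigenspace L \<kappa>" "\<forall>e\<in>B. inner f e = 0" for \<kappa> f
    using B that unfolding spectral_basis_def by blast
  ultimately show False
    using g(3) \<open>\<kappa> < \<omega>\<close> less_imp_le by blast
qed

lemma inner_T_le:
  assumes s: "0 < s" "s + s < 1" and B: "spectral_basis \<omega> B"
    and compact: "\<And>f :: nat \<Rightarrow> 'h. (\<And>n. norm (f n) \<le> 1) \<Longrightarrow>
      \<exists>r l. strict_mono (r :: nat \<Rightarrow> nat) \<and> (\<lambda>n. T s (T s (f (r n)))) \<longlonglongrightarrow> l"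
  shows "inner (T (s + s) f) f \<le> (\<Sum>e\<in>B. (inner f e)\<^sup>2) + exp (- \<omega> * (s + s)) * (norm f)\<^sup>2"
proof -
  have ob: "finite B" "orthonormal B" using B by (auto simp: spectral_basis_def)
  have s1: "s < 1" using s by simp
  define p where "p = orthogonal_proj B f"
  define q where "q = f - p"
  interpret bounded_linear "T (s + s)" using s by (intro bounded_linear_T) auto
  obtain k where k: "\<And>e. e \<in> B \<Longrightarrow> e \<in> eigenspace L (k e)"
    using B unfolding spectral_basis_def by metis
  have Te: "T (s + s) e = exp (- k e * (s + s)) *\<^sub>R e" if "e \<in> B" for e
    using T_eigenvector[OF k[OF that]] s by auto
  have qe: "inner q e = 0" if "e \<in> B" for e
    using inner_diff_orthogonal_proj[OF ob that] by (simp add: q_def p_def)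
  have Tp: "T (s + s) p = (\<Sum>e\<in>B. (inner f e * exp (- k e * (s + s))) *\<^sub>R e)"
    unfolding p_def orthogonal_proj_def sum scaleR
    by (intro sum.cong refl) (simp only: Te scaleR_scaleR)
  have "inner (T (s + s) p) q = 0"
    unfolding Tp inner_sum_left using qe by (simp add: inner_commute)
  moreover have "inner (T (s + s) q) p = 0"
    using calculation T_symmetric[of "s + s" p q] s by (simp add: inner_commute)
  ultimately have "inner (T (s + s) f) f = inner (T (s + s) p) p + inner (T (s + s) q) q"
    using add[of p q] by (simp add: q_def inner_add_left inner_add_right algebra_simps)
  moreover have "inner (T (s + s) p) p \<le> (\<Sum>e\<in>B. (inner f e)\<^sup>2)"
  proof -
    have "inner (T (s + s) p) p = (\<Sum>e\<in>B. inner f e * exp (- k e * (s + s)) * inner p e)"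
      unfolding Tp inner_sum_left by (simp add: inner_commute mult.assoc)
    also have "\<dots> \<le> (\<Sum>e\<in>B. (inner f e)\<^sup>2)"
    proof (rule sum_mono)
      fix e assume e: "e \<in> B"
      have "e \<noteq> 0" using orthonormal_norm[OF ob(2) e] by auto
      then have "0 \<le> k e" using eigenvalue_nonneg[OF nonneg k[OF e]] by simp
      then have "exp (- k e * (s + s)) \<le> 1" using s by simp
      then have "(inner f e)\<^sup>2 * exp (- k e * (s + s)) \<le> (inner f e)\<^sup>2"
        using mult_left_le[of _ "(inner f e)\<^sup>2"] by simp
      moreover have "inner p e = inner f e"
        unfolding p_def by (rule inner_orthogonal_proj[OF ob e])
      ultimately show "inner f e * exp (- k e * (s + s)) * inner p e \<le> (inner f e)\<^sup>2"
        by (simp add: power2_eq_square algebra_simps)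
    qed
    finally show ?thesis .
  qed
  moreover have "inner (T (s + s) q) q \<le> exp (- \<omega> * (s + s)) * (norm f)\<^sup>2"
  proof -
    have "inner (T (s + s) q) q = (norm (T s q))\<^sup>2"
      using inner_T_T s(1) s1 by blast
    also have "\<dots> \<le> (exp (- \<omega> * s) * norm q)\<^sup>2"
      using T_decay[OF s(1) s1 B compact qe] by (intro power_mono) auto
    also have "\<dots> = exp (- \<omega> * (s + s)) * (norm q)\<^sup>2"
      by (simp add: power_mult_distrib power2_eq_square[of "exp _"] distrib_left flip: exp_add)
    also have "\<dots> \<le> exp (- \<omega> * (s + s)) * (norm f)\<^sup>2"
      using Pythagoras_orthogonal_proj[OF ob, of f] by (simp add: q_def p_def)
    finally show ?thesis .
  qed
  ultimately show ?thesis by linarith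
qed

end

section \<open>Integral operators with bounded kernels on \<open>L\<^sub>2\<close>\<close>

lemma space_mu: "space (mu :: 'a::compact_metric_measure_space measure) = UNIV"
  using sets_eq_imp_space_eq[OF sets_mu] by simp

lemma finite_measure_mu: "finite_measure (mu :: 'a::compact_metric_measure_space measure)"
  using mu_finite[where 'a = 'a] by (intro finite_measureI) (simp add: space_mu)

lemma ball_in_sets_mu [measurable]:
  "ball x r \<in> sets (mu :: 'a::compact_metric_measure_space measure)"
  by (simp add: sets_mu)

lemma l2_eq_rep: "l2_eq (rep_l2 f) (rep_l2 f)"
  using Quotient_rep_reflp[OF Quotient_l2] .

lemma square_integrable_rep: "square_integrable (rep_l2 f)"
  using l2_eq_rep by (auto simp: l2_eq_def)

lemma abs_rep_l2: "abs_l2 (rep_l2 f) = f"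
  using Quotient_abs_rep[OF Quotient_l2] .

lemma l2_eq_refl: "l2_eq \<phi> \<phi> \<longleftrightarrow> square_integrable \<phi>"
  by (auto simp: l2_eq_def)

lemma rep_abs_l2: "square_integrable \<phi> \<Longrightarrow> AE x in mu. rep_l2 (abs_l2 \<phi>) x = \<phi> x"
  using Quotient_rep_abs[OF Quotient_l2, of \<phi>] by (simp add: l2_eq_refl) (simp add: l2_eq_def)

lemma inner_abs_l2:
  "square_integrable \<phi> \<Longrightarrow> square_integrable \<psi> \<Longrightarrow>
    inner (abs_l2 \<phi>) (abs_l2 \<psi>) = (\<integral>x. \<phi> x * \<psi> x \<partial>mu)"
  by (intro inner_l2.abs_eq) (simp_all add: l2_eq_refl)

lemma norm_rep_l2: "(norm f)\<^sup>2 = (\<integral>x. (rep_l2 f x)\<^sup>2 \<partial>mu)"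
  unfolding power2_norm_eq_inner
  using inner_abs_l2[OF square_integrable_rep square_integrable_rep, of f f]
  by (simp add: abs_rep_l2 power2_eq_square)

lemma integrable_rep_square: "integrable mu (\<lambda>x. (rep_l2 f x)\<^sup>2)"
  using square_integrable_rep by (auto simp: square_integrable_def)

lemma square_integrable_diff:
  assumes "square_integrable \<phi>" "square_integrable \<psi>"
  shows "square_integrable (\<lambda>x. \<phi> x - \<psi> x)"
  using square_integrable_add[OF assms(1) square_integrable_scale[OF assms(2), of "-1"]] by simp

lemma abs_l2_diff:
  assumes "square_integrable \<phi>" "square_integrable \<psi>"
  shows "abs_l2 \<phi> - abs_l2 \<psi> = abs_l2 (\<lambda>x. \<phi> x - \<psi> x)"
proof -
  have "- abs_l2 \<psi> = abs_l2 (\<lambda>x. - \<psi> x)"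
    by (intro uminus_l2.abs_eq) (simp add: l2_eq_refl assms)
  moreover have "square_integrable (\<lambda>x. - \<psi> x)"
    using square_integrable_scale[OF assms(2), of "-1"] by simp
  ultimately show ?thesis
    unfolding minus_l2_def
    using plus_l2.abs_eq[of \<phi> "\<lambda>x. - \<psi> x"] assms by (simp add: l2_eq_refl)
qed

lemma rep_l2_diff: "AE x in mu. rep_l2 (f - g) x = rep_l2 f x - rep_l2 g x"
  using rep_abs_l2[OF square_integrable_diff[OF square_integrable_rep square_integrable_rep], of f g]
    abs_l2_diff[OF square_integrable_rep square_integrable_rep, of f g]
  by (simp add: abs_rep_l2)

lemma square_integrable_bounded:
  fixes \<phi> :: "'a::compact_metric_measure_space \<Rightarrow> real"
  assumes "\<phi> \<in> borel_measurable mu" "AE x in mu. \<bar>\<phi> x\<bar> \<le> M"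
  shows "square_integrable \<phi>"
proof -
  interpret finite_measure "mu :: 'a measure" by (rule finite_measure_mu)
  have "integrable mu (\<lambda>x. (\<phi> x)\<^sup>2)"
  proof (rule integrable_const_bound[where B = "M\<^sup>2"])
    show "AE x in mu. norm ((\<phi> x)\<^sup>2) \<le> M\<^sup>2"
      using assms(2)
    proof eventually_elim
      case (elim x)
      then show ?case using power_mono[of "\<bar>\<phi> x\<bar>" M 2] by simp
    qed
  qed (use assms(1) in measurable)
  then show ?thesis using assms(1) by (simp add: square_integrable_def)
qed

lemma norm_l2_le_bound:
  fixes f :: "'a::compact_metric_measure_space l2"
  assumes "AE x in mu. \<bar>rep_l2 f x\<bar> \<le> M" "0 \<le> M"
  shows "norm f \<le> M * sqrt (measure mu (UNIV :: 'a set))"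
proof -
  interpret finite_measure "mu :: 'a measure" by (rule finite_measure_mu)
  have "(norm f)\<^sup>2 \<le> (\<integral>x. M\<^sup>2 \<partial>(mu :: 'a measure))"
    unfolding norm_rep_l2
  proof (rule integral_mono_AE)
    show "AE x in mu. (rep_l2 f x)\<^sup>2 \<le> M\<^sup>2"
      using assms(1) by eventually_elim (use assms(2) in \<open>simp add: abs_le_square_iff[symmetric]\<close>)
  qed (simp_all add: integrable_rep_square)
  also have "\<dots> = (M * sqrt (measure mu (UNIV :: 'a set)))\<^sup>2"
    by (simp add: space_mu power_mult_distrib mult.commute)
  finally show ?thesis
    by (rule power2_le_imp_le) (use assms(2) in simp)
qed

locale bounded_kernel_operator =
  fixes K :: "'a::compact_metric_measure_space l2 \<Rightarrow> 'a l2" and p :: "'a \<Rightarrow> 'a \<Rightarrow> real" and M :: real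
  assumes kernel_measurable: "(\<lambda>(x, y). p x y) \<in> borel_measurable (mu \<Otimes>\<^sub>M mu)"
    and kernel_bound: "\<And>x y. \<bar>p x y\<bar> \<le> M"
    and kernel: "\<And>f. AE x in mu. rep_l2 (K f) x = (\<integral>y. p x y * rep_l2 f y \<partial>mu)"
begin

lemma M_nonneg: "0 \<le> M"
  using kernel_bound[of undefined undefined] abs_ge_zero order_trans by blast

lemma section_measurable: "p x \<in> borel_measurable mu"
  using measurable_Pair2[OF kernel_measurable, of x] by (simp add: space_mu)

lemma square_integrable_section: "square_integrable (p x)"
  using section_measurable kernel_bound by (intro square_integrable_bounded[where M = M]) auto

lemma norm_section_le: "norm (abs_l2 (p x)) \<le> M * sqrt (measure mu (UNIV :: 'a set))"
proof (rule norm_l2_le_bound)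
  show "AE y in mu. \<bar>rep_l2 (abs_l2 (p x)) y\<bar> \<le> M"
    using rep_abs_l2[OF square_integrable_section[of x]] by eventually_elim (simp add: kernel_bound)
qed (rule M_nonneg)

lemma kernel_inner: "AE x in mu. rep_l2 (K f) x = inner (abs_l2 (p x)) f"
  using kernel[of f]
proof eventually_elim
  case (elim x)
  then show ?case
    using inner_abs_l2[OF square_integrable_section square_integrable_rep, of x f]
    by (simp add: abs_rep_l2)
qed

lemma AE_bound: "AE x in mu. \<bar>rep_l2 (K f) x\<bar> \<le> M * sqrt (measure mu (UNIV :: 'a set)) * norm f"
  using kernel_inner[of f]
proof eventually_elim
  case (elim x)
  have "\<bar>inner (abs_l2 (p x)) f\<bar> \<le> norm (abs_l2 (p x)) * norm f"
    by (rule Cauchy_Schwarz_ineq2)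
  also have "\<dots> \<le> M * sqrt (measure mu (UNIV :: 'a set)) * norm f"
    by (intro mult_right_mono norm_section_le) auto
  finally show ?case using elim by simp
qed

lemma norm_le: "norm (K f) \<le> M * measure mu (UNIV :: 'a set) * norm f"
proof -
  have "norm (K f) \<le> M * sqrt (measure mu (UNIV :: 'a set)) * norm f * sqrt (measure mu (UNIV :: 'a set))"
    using M_nonneg by (intro norm_l2_le_bound AE_bound) auto
  then show ?thesis by (simp add: mult.assoc mult.left_commute mult.commute)
qed

lemma Hilbert_Schmidt: "Hilbert_Schmidt K ((M * measure mu (UNIV :: 'a set))\<^sup>2)"
  unfolding Hilbert_Schmidt_def
proof (intro allI impI, elim conjE)
  interpret finite_measure "mu :: 'a measure" by (rule finite_measure_mu)
  fix B :: "'a l2 set" assume B: "finite B" "orthonormal B"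
  have "(\<Sum>e\<in>B. (norm (K e))\<^sup>2) = (\<integral>x. (\<Sum>e\<in>B. (rep_l2 (K e) x)\<^sup>2) \<partial>mu)"
    unfolding norm_rep_l2 by (intro Bochner_Integration.integral_sum[symmetric] integrable_rep_square)
  also have "\<dots> \<le> (\<integral>x. (M * sqrt (measure mu (UNIV :: 'a set)))\<^sup>2 \<partial>(mu :: 'a measure))"
  proof (rule integral_mono_AE)
    have "AE x in mu. \<forall>e\<in>B. rep_l2 (K e) x = inner (abs_l2 (p x)) e"
      using B(1) kernel_inner by (intro AE_finite_allI) auto
    then show "AE x in mu. (\<Sum>e\<in>B. (rep_l2 (K e) x)\<^sup>2) \<le> (M * sqrt (measure mu (UNIV :: 'a set)))\<^sup>2"
    proof eventually_elim
      case (elim x)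
      then have "(\<Sum>e\<in>B. (rep_l2 (K e) x)\<^sup>2) = (\<Sum>e\<in>B. (inner (abs_l2 (p x)) e)\<^sup>2)"
        by (intro sum.cong) auto
      also have "\<dots> \<le> (norm (abs_l2 (p x)))\<^sup>2"
        by (rule Bessel_inequality[OF B])
      also have "\<dots> \<le> (M * sqrt (measure mu (UNIV :: 'a set)))\<^sup>2"
        by (intro power_mono norm_section_le) auto
      finally show ?case .
    qed
  qed (auto intro!: Bochner_Integration.integrable_sum integrable_rep_square)
  also have "\<dots> = (M * measure mu (UNIV :: 'a set))\<^sup>2"
    by (simp add: space_mu power_mult_distrib power2_eq_square)
  finally show "(\<Sum>e\<in>B. (norm (K e))\<^sup>2) \<le> (M * measure mu (UNIV :: 'a set))\<^sup>2" .
qed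

text \<open>The images of a Cauchy sequence are uniformly Cauchy off a null set, so they converge
  without appeal to the completeness of \<open>L\<^sub>2\<close>.\<close>

lemma Cauchy_image_convergent:
  assumes K: "bounded_linear K" and h: "Cauchy (h :: nat \<Rightarrow> 'a l2)"
  shows "convergent (\<lambda>n. K (h n))"
proof -
  interpret K: bounded_linear K by fact
  interpret finite_measure "mu :: 'a measure" by (rule finite_measure_mu)
  define C where "C = M * sqrt (measure mu (UNIV :: 'a set))"
  have C: "0 \<le> C" using M_nonneg by (simp add: C_def)
  define u where "u n = rep_l2 (K (h n))" for n
  have u_meas [measurable]: "u n \<in> borel_measurable mu" for n
    using square_integrable_rep by (auto simp: u_def square_integrable_def)
  have "AE x in mu. \<bar>u m x - u n x\<bar> \<le> C * norm (h m - h n)" for m n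
    using AE_bound[of "h m - h n"] rep_l2_diff[of "K (h m)" "K (h n)"]
    by eventually_elim (simp add: u_def C_def K.diff)
  then have AE_u: "AE x in mu. \<forall>m n. \<bar>u m x - u n x\<bar> \<le> C * norm (h m - h n)"
    by (simp add: AE_all_countable)
  have small: "\<exists>N. \<forall>m\<ge>N. \<forall>n\<ge>N. C * norm (h m - h n) < \<epsilon>" if "0 < \<epsilon>" for \<epsilon>
  proof -
    obtain N where N: "\<And>m n. m \<ge> N \<Longrightarrow> n \<ge> N \<Longrightarrow> norm (h m - h n) < \<epsilon> / (C + 1)"
      using h C \<open>0 < \<epsilon>\<close> unfolding Cauchy_iff
      by (metis add_nonneg_pos divide_pos_pos zero_less_one)
    have "C * norm (h m - h n) < \<epsilon>" if mn: "m \<ge> N" "n \<ge> N" for m n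
    proof -
      have "C * norm (h m - h n) \<le> (C + 1) * norm (h m - h n)"
        by (intro mult_right_mono) auto
      also have "\<dots> < \<epsilon>"
        using N[OF mn] C by (simp add: pos_less_divide_eq mult.commute)
      finally show ?thesis .
    qed
    then show ?thesis by blast
  qed
  define v where "v x = lim (\<lambda>n. u n x)" for x
  have v_meas [measurable]: "v \<in> borel_measurable mu"
    unfolding v_def[abs_def] by measurable
  have AE_v: "AE x in mu. \<forall>n \<epsilon>. (\<forall>m\<ge>n. C * norm (h m - h n) \<le> \<epsilon>) \<longrightarrow> \<bar>u n x - v x\<bar> \<le> \<epsilon>"
    using AE_u
  proof eventually_elim
    case (elim x)
    have "Cauchy (\<lambda>n. u n x)"
      unfolding Cauchy_iff
    proof (intro allI impI)
      fix \<epsilon> :: real assume "0 < \<epsilon>"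
      then obtain N where "\<forall>m\<ge>N. \<forall>n\<ge>N. C * norm (h m - h n) < \<epsilon>" using small by blast
      then show "\<exists>N. \<forall>m\<ge>N. \<forall>n\<ge>N. norm (u m x - u n x) < \<epsilon>"
        using elim by (metis le_less_trans real_norm_def)
    qed
    then have lim: "(\<lambda>n. u n x) \<longlonglongrightarrow> v x"
      unfolding v_def by (simp add: Cauchy_convergent_iff convergent_LIMSEQ_iff)
    show ?case
    proof (intro allI impI)
      fix n \<epsilon> assume \<epsilon>: "\<forall>m\<ge>n. C * norm (h m - h n) \<le> \<epsilon>"
      have "(\<lambda>m. \<bar>u n x - u m x\<bar>) \<longlonglongrightarrow> \<bar>u n x - v x\<bar>"
        by (intro tendsto_intros lim)
      moreover have "\<bar>u n x - u m x\<bar> \<le> \<epsilon>" if "m \<ge> n" for m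
        using elim \<epsilon> that by (metis abs_minus_commute order_trans)
      ultimately show "\<bar>u n x - v x\<bar> \<le> \<epsilon>"
        by (meson Lim_bounded)
    qed
  qed
  have dist: "square_integrable (\<lambda>x. u n x - v x) \<and> norm (abs_l2 (\<lambda>x. u n x - v x)) \<le> \<epsilon> * sqrt (measure mu (UNIV :: 'a set))"
    if "\<forall>m\<ge>n. C * norm (h m - h n) \<le> \<epsilon>" for n \<epsilon>
  proof -
    have AE: "AE x in mu. \<bar>u n x - v x\<bar> \<le> \<epsilon>"
      using AE_v by eventually_elim (use that in blast)
    have "0 \<le> \<epsilon>" using that C by (metis mult_nonneg_nonneg norm_ge_zero order_refl order_trans)
    have sq: "square_integrable (\<lambda>x. u n x - v x)"
      using AE by (intro square_integrable_bounded[where M = \<epsilon>]) measurable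
    moreover have "norm (abs_l2 (\<lambda>x. u n x - v x)) \<le> \<epsilon> * sqrt (measure mu (UNIV :: 'a set))"
    proof (rule norm_l2_le_bound[OF _ \<open>0 \<le> \<epsilon>\<close>])
      show "AE x in mu. \<bar>rep_l2 (abs_l2 (\<lambda>x. u n x - v x)) x\<bar> \<le> \<epsilon>"
        using rep_abs_l2[OF sq] AE by eventually_elim simp
    qed
    ultimately show ?thesis by blast
  qed
  obtain N where "\<forall>m\<ge>N. \<forall>n\<ge>N. C * norm (h m - h n) < 1" using small[of 1] by auto
  then have "\<forall>m\<ge>N. C * norm (h m - h N) \<le> 1" by (simp add: less_imp_le)
  then have "square_integrable (\<lambda>x. u N x - v x)" using dist by blast
  then have "square_integrable (\<lambda>x. u N x - (u N x - v x))"
    unfolding u_def by (rule square_integrable_diff[OF square_integrable_rep])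
  then have sv: "square_integrable v" by simp
  have "(\<lambda>n. K (h n)) \<longlonglongrightarrow> abs_l2 v"
  proof (rule LIMSEQ_I)
    fix r :: real assume "0 < r"
    define s where "s = sqrt (measure mu (UNIV :: 'a set))"
    have s: "0 \<le> s" by (simp add: s_def)
    then have "0 < r / (s + 1)" using \<open>0 < r\<close> by simp
    then obtain N where N: "\<forall>m\<ge>N. \<forall>n\<ge>N. C * norm (h m - h n) < r / (s + 1)"
      using small by blast
    have "norm (K (h n) - abs_l2 v) < r" if n: "n \<ge> N" for n
    proof -
      have "\<forall>m\<ge>n. C * norm (h m - h n) \<le> r / (s + 1)"
        using N n by (meson less_imp_le order_trans)
      then have "norm (abs_l2 (\<lambda>x. u n x - v x)) \<le> r / (s + 1) * s"
        using dist s_def by blast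
      moreover have "K (h n) - abs_l2 v = abs_l2 (\<lambda>x. u n x - v x)"
        using abs_l2_diff[OF square_integrable_rep[of "K (h n)"] sv]
        by (simp add: u_def abs_rep_l2)
      moreover have "r / (s + 1) * s < r"
        using s \<open>0 < r\<close> by (simp add: field_simps)
      ultimately show ?thesis by simp
    qed
    then show "\<exists>N. \<forall>n\<ge>N. norm (K (h n) - abs_l2 v) < r" by blast
  qed
  then show ?thesis by (rule convergentI)
qed

lemma square_compact:
  assumes K: "bounded_linear K" and f: "\<And>n. norm (f n :: 'a l2) \<le> 1"
  shows "\<exists>r l. strict_mono (r :: nat \<Rightarrow> nat) \<and> (\<lambda>n. K (K (f (r n)))) \<longlonglongrightarrow> l"
proof -
  obtain r where r: "strict_mono (r :: nat \<Rightarrow> nat)" "Cauchy (\<lambda>n. K (f (r n)))"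
    using Hilbert_Schmidt_Cauchy_subsequence[OF K Hilbert_Schmidt f] .
  then show ?thesis
    using Cauchy_image_convergent[OF K r(2)] by (auto simp: convergent_def)
qed

end

definition unit_indicator :: "'a::compact_metric_measure_space set \<Rightarrow> 'a \<Rightarrow> real" where
  "unit_indicator S x = indicator S x / sqrt (measure mu S)"

lemma square_integrable_unit_indicator:
  assumes "S \<in> sets mu" shows "square_integrable (unit_indicator S)"
proof (rule square_integrable_bounded)
  show "unit_indicator S \<in> borel_measurable mu"
    unfolding unit_indicator_def[abs_def] using assms by measurable
  show "AE x in mu. \<bar>unit_indicator S x\<bar> \<le> 1 / sqrt (measure mu S)"
    by (intro AE_I2) (simp add: unit_indicator_def indicator_def)
qed

lemma integrable_unit_indicator:
  assumes "S \<in> sets (mu :: 'a::compact_metric_measure_space measure)"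
  shows "integrable mu (unit_indicator S)"
proof -
  interpret finite_measure "mu :: 'a measure" by (rule finite_measure_mu)
  show ?thesis
    unfolding unit_indicator_def[abs_def]
    using assms by (intro integrable_divide integrable_real_indicator) (simp_all add: less_top[symmetric])
qed

lemma inner_unit_indicator_same:
  assumes "S \<in> sets (mu :: 'a::compact_metric_measure_space measure)" "0 < measure mu S"
  shows "inner (abs_l2 (unit_indicator S)) (abs_l2 (unit_indicator S)) = 1"
proof -
  interpret finite_measure "mu :: 'a measure" by (rule finite_measure_mu)
  have "(\<lambda>x. unit_indicator S x * unit_indicator S x) = (\<lambda>x. indicator S x / measure mu S)"
    by (auto simp: unit_indicator_def indicator_def)
  then show ?thesis
    using assms by (simp add: inner_abs_l2 square_integrable_unit_indicator)
qed

lemma inner_unit_indicator_disjoint: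
  assumes "S \<in> sets mu" "S' \<in> sets mu" "S \<inter> S' = {}"
  shows "inner (abs_l2 (unit_indicator S)) (abs_l2 (unit_indicator S')) = 0"
proof -
  have "(\<lambda>x. unit_indicator S x * unit_indicator S' x) = (\<lambda>x. 0)"
  proof
    show "unit_indicator S x * unit_indicator S' x = 0" for x
      using assms(3) by (auto simp: unit_indicator_def indicator_def)
  qed
  then show ?thesis
    using assms by (simp add: inner_abs_l2 square_integrable_unit_indicator)
qed

lemma (in bounded_kernel_operator) inner_unit_indicator_ge:
  assumes S: "S \<in> sets (mu :: 'a measure)" "0 < measure mu S"
    and m: "\<And>x y. x \<in> S \<Longrightarrow> y \<in> S \<Longrightarrow> m \<le> p x y"
  shows "m * measure mu S \<le> inner (K (abs_l2 (unit_indicator S))) (abs_l2 (unit_indicator S))"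
proof -
  interpret finite_measure "mu :: 'a measure" by (rule finite_measure_mu)
  let ?\<phi> = "unit_indicator S" and ?V = "measure mu S"
  note sq = square_integrable_unit_indicator[OF S(1)]
  have AE: "AE x in mu. m * ?\<phi> x * sqrt ?V * sqrt ?V \<le> rep_l2 (K (abs_l2 ?\<phi>)) x * ?\<phi> x * sqrt ?V"
    using kernel_inner[of "abs_l2 ?\<phi>"]
  proof eventually_elim
    case (elim x)
    show ?case
    proof (cases "x \<in> S")
      case True
      have "m * sqrt ?V = (\<integral>y. m * ?\<phi> y \<partial>mu)"
        using S by (simp add: unit_indicator_def[abs_def] real_div_sqrt flip: times_divide_eq_right)
      also have "\<dots> \<le> (\<integral>y. p x y * ?\<phi> y \<partial>mu)"
      proof (rule integral_mono)
        show "integrable mu (\<lambda>y. m * ?\<phi> y)"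
          by (intro integrable_mult_right integrable_unit_indicator S)
        show "integrable mu (\<lambda>y. p x y * ?\<phi> y)"
          by (rule square_integrable_mult_integrable[OF square_integrable_section sq])
        show "m * ?\<phi> y \<le> p x y * ?\<phi> y" for y
          using m[OF True, of y] by (auto simp: unit_indicator_def indicator_def intro!: divide_right_mono)
      qed
      also have "\<dots> = rep_l2 (K (abs_l2 ?\<phi>)) x"
        using elim inner_abs_l2[OF square_integrable_section sq] by simp
      finally have "m * sqrt ?V * (?\<phi> x * sqrt ?V) \<le> rep_l2 (K (abs_l2 ?\<phi>)) x * (?\<phi> x * sqrt ?V)"
        by (intro mult_right_mono) (auto simp: unit_indicator_def)
      then show ?thesis by (simp add: mult_ac)
    qed (simp add: unit_indicator_def)
  qed
  have eq: "inner (K (abs_l2 ?\<phi>)) (abs_l2 ?\<phi>) = (\<integral>x. rep_l2 (K (abs_l2 ?\<phi>)) x * ?\<phi> x \<partial>mu)"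
    using inner_abs_l2[OF square_integrable_rep sq, of "K (abs_l2 ?\<phi>)"] by (simp add: abs_rep_l2)
  have "m * ?V = (\<integral>x. m * ?\<phi> x * sqrt ?V \<partial>mu)"
    using S by (simp add: unit_indicator_def[abs_def])
  also have "\<dots> \<le> (\<integral>x. rep_l2 (K (abs_l2 ?\<phi>)) x * ?\<phi> x \<partial>mu)"
  proof (rule integral_mono_AE)
    show "integrable mu (\<lambda>x. m * ?\<phi> x * sqrt ?V)"
      by (intro integrable_mult_left integrable_mult_right integrable_unit_indicator S)
    show "integrable mu (\<lambda>x. rep_l2 (K (abs_l2 ?\<phi>)) x * ?\<phi> x)"
      by (rule square_integrable_mult_integrable[OF square_integrable_rep sq])
    show "AE x in mu. m * ?\<phi> x * sqrt ?V \<le> rep_l2 (K (abs_l2 ?\<phi>)) x * ?\<phi> x"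
      using AE by eventually_elim (rule mult_right_le_imp_le[OF _ real_sqrt_gt_zero[OF S(2)]])
  qed
  finally show ?thesis using eq by simp
qed

definition doubling_const :: "'a::compact_metric_measure_space itself \<Rightarrow> real \<Rightarrow> bool" where
  "doubling_const _ q \<longleftrightarrow> 1 < q \<and> (\<forall>(x::'a) r. 0 < r \<longrightarrow> 0 < measure mu (ball x r) \<and>
      measure mu (ball x (2 * r)) \<le> q * measure mu (ball x r))"

lemma doubling_const_exists:
  assumes "doubling TYPE('a::compact_metric_measure_space)"
  obtains q where "doubling_const TYPE('a) q"
proof -
  obtain D where D: "0 < D" "\<And>(x::'a) r. 0 < r \<Longrightarrow> 0 < measure mu (ball x (2 * r)) \<and>
      measure mu (ball x (2 * r)) \<le> 2 powr D * measure mu (ball x r)"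
    using assms by (auto simp: doubling_def)
  have "0 < measure mu (ball x r)" if "0 < r" for x :: 'a and r
    using D(2)[of "r / 2" x] that by simp
  then show thesis
    using that[of "2 powr D"] D by (auto simp: doubling_const_def)
qed

lemma measure_ball_pow:
  assumes "doubling_const TYPE('a::compact_metric_measure_space) q" "0 < r"
  shows "measure mu (ball (x::'a) (2 ^ k * r)) \<le> q ^ k * measure mu (ball x r)"
proof (induction k)
  case (Suc k)
  have q: "0 < q" using assms(1) by (simp add: doubling_const_def)
  have "measure mu (ball x (2 * (2 ^ k * r))) \<le> q * measure mu (ball x (2 ^ k * r))"
    using assms by (simp add: doubling_const_def)
  also have "\<dots> \<le> q * (q ^ k * measure mu (ball x r))"
    using q Suc by (intro mult_left_mono) auto
  finally show ?case by (simp add: mult.assoc)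
qed simp

lemma measure_ball_mono:
  assumes "ball x r \<subseteq> ball y r'"
  shows "measure mu (ball (x::'a::compact_metric_measure_space) r) \<le> measure mu (ball y r')"
  using assms by (intro finite_measure.finite_measure_mono finite_measure_mu) auto

lemma measure_ball_lower_bound:
  assumes q: "doubling_const TYPE('a::compact_metric_measure_space) q" and r: "0 < r"
  obtains m where "0 < m" "\<And>x::'a. m \<le> measure mu (ball x r)"
proof -
  have "bounded (UNIV :: 'a set)"
    using compact_space by (rule compact_imp_bounded)
  then obtain R where R: "\<And>x y::'a. dist x y \<le> R"
    by (auto simp: bounded_two_points)
  obtain k :: nat where "R / r < 2 ^ k"
    using real_arch_pow[of 2 "R / r"] by auto
  then have k: "R < 2 ^ k * r" using r by (simp add: pos_divide_less_eq)
  have q0: "0 < q ^ k" using q by (simp add: doubling_const_def)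
  let ?V = "measure mu (UNIV :: 'a set)"
  have ball: "ball x (2 ^ k * r) = UNIV" for x :: 'a
    using le_less_trans[OF R k] by auto
  have "0 < measure mu (ball (x::'a) (2 ^ k * r))" for x
    using q r by (simp add: doubling_const_def)
  then have "0 < ?V" by (simp only: ball)
  then have "0 < ?V / q ^ k" using q0 by simp
  moreover have "?V / q ^ k \<le> measure mu (ball x r)" for x :: 'a
    using measure_ball_pow[OF q r, of x k] q0 ball[of x] by (simp add: pos_divide_le_eq mult.commute)
  ultimately show thesis by (rule that)
qed

lemma Gaussian_estimatesE:
  assumes "Gaussian_estimates (P :: real \<Rightarrow> 'a::compact_metric_measure_space \<Rightarrow> 'a \<Rightarrow> real)"
  obtains C1 C2 c1 c2 where "0 < C1" "0 < C2" "0 < c1" "0 < c2"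
    "\<And>t x y. 0 < t \<Longrightarrow> t < 1 \<Longrightarrow> C1 * exp (- (c1 * (dist x y)\<^sup>2 / t))
        / sqrt (measure mu (ball x (sqrt t)) * measure mu (ball y (sqrt t))) \<le> P t x y"
    "\<And>t x y. 0 < t \<Longrightarrow> t < 1 \<Longrightarrow> P t x y \<le> C2 * exp (- (c2 * (dist x y)\<^sup>2 / t))
        / sqrt (measure mu (ball x (sqrt t)) * measure mu (ball y (sqrt t)))"
proof -
  define Q where "Q C1 C2 c1 c2 \<longleftrightarrow> (\<forall>t (x::'a) y. 0 < t \<and> t < 1 \<longrightarrow>
      C1 * exp (- (c1 * (dist x y)\<^sup>2 / t))
        / sqrt (measure mu (ball x (sqrt t)) * measure mu (ball y (sqrt t))) \<le> P t x y \<and>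
      P t x y \<le> C2 * exp (- (c2 * (dist x y)\<^sup>2 / t))
        / sqrt (measure mu (ball x (sqrt t)) * measure mu (ball y (sqrt t))))" for C1 C2 c1 c2
  have "\<exists>C1>0. \<exists>C2>0. \<exists>c1>0. \<exists>c2>0. Q C1 C2 c1 c2"
    using assms unfolding Gaussian_estimates_def Q_def .
  then obtain C1 C2 c1 c2 where C: "0 < C1" "0 < C2" "0 < c1" "0 < c2" and Q: "Q C1 C2 c1 c2"
    by blast
  show thesis
    by (rule that[OF C]) (use Q in \<open>simp_all add: Q_def\<close>)
qed

lemma Gaussian_kernel_bound:
  assumes q: "doubling_const TYPE('a::compact_metric_measure_space) q"
    and P: "Gaussian_estimates (P :: real \<Rightarrow> 'a \<Rightarrow> 'a \<Rightarrow> real)" and a: "0 < a" "a < 1"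
  shows "\<exists>M. \<forall>t x y. a \<le> t \<and> t < 1 \<longrightarrow> \<bar>P t x y\<bar> \<le> M"
proof -
  obtain C1 C2 c1 c2 where C: "0 < C1" "0 < C2" "0 < c1" "0 < c2"
    and low: "\<And>t x y. 0 < t \<Longrightarrow> t < 1 \<Longrightarrow> C1 * exp (- (c1 * (dist x y)\<^sup>2 / t))
        / sqrt (measure mu (ball x (sqrt t)) * measure mu (ball y (sqrt t))) \<le> P t x y"
    and up: "\<And>t x y. 0 < t \<Longrightarrow> t < 1 \<Longrightarrow> P t x y \<le> C2 * exp (- (c2 * (dist x y)\<^sup>2 / t))
        / sqrt (measure mu (ball x (sqrt t)) * measure mu (ball y (sqrt t)))"
    by (rule Gaussian_estimatesE[OF P]) (rule that)
  obtain m where m: "0 < m" "\<And>x::'a. m \<le> measure mu (ball x (sqrt a))"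
    using measure_ball_lower_bound[OF q, of "sqrt a"] a by auto
  have "\<bar>P t x y\<bar> \<le> C2 / m" if t: "a \<le> t" "t < 1" for t x y
  proof -
    have mb: "m \<le> measure mu (ball z (sqrt t))" for z :: 'a
      using order_trans[OF m(2)[of z] measure_ball_mono[OF subset_ball]] t by simp
    have "m * m \<le> measure mu (ball x (sqrt t)) * measure mu (ball y (sqrt t))"
      using m(1) mb by (intro mult_mono) auto
    then have V: "m \<le> sqrt (measure mu (ball x (sqrt t)) * measure mu (ball y (sqrt t)))" (is "m \<le> ?V")
      by (intro real_le_rsqrt) (simp add: power2_eq_square)
    have "0 \<le> C1 * exp (- (c1 * (dist x y)\<^sup>2 / t)) / ?V"
      using C by simp
    then have "0 \<le> P t x y" using low[of t x y] t a by linarith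
    moreover have "C2 * exp (- (c2 * (dist x y)\<^sup>2 / t)) / ?V \<le> C2 / m"
    proof (rule frac_le)
      show "C2 * exp (- (c2 * (dist x y)\<^sup>2 / t)) \<le> C2"
        using C t a by (simp add: mult_le_cancel_left1)
    qed (use C m V in auto)
    ultimately show ?thesis using up[of t x y] t a by linarith
  qed
  then show ?thesis by blast
qed

lemma super_exponential_decay:
  assumes "1 < (q::real)" "0 < \<delta>"
  obtains k :: nat where "exp (- (4 ^ k)) * q ^ (k + 2) < \<delta>"
proof -
  have "(\<lambda>k::nat. exp (- (4 ^ k)) * q ^ (k + 2)) \<longlonglongrightarrow> 0"
    using assms(1) by real_asymp
  then have "\<forall>\<^sub>F k in sequentially. exp (- (4 ^ k)) * q ^ (k + 2) < \<delta>"
    using assms(2) by (rule order_tendstoD)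
  then show thesis using that by (auto simp: eventually_sequentially)
qed

section \<open>Counting lattice points by eigenvalues\<close>

lemma card_lattice_le_eigenvalue_count:
  fixes L :: "('a::compact_metric_measure_space l2 \<times> 'a l2) set"
  assumes q: "doubling_const TYPE('a) q" and B: "essentially_self_adjoint_with_smooth_algebra L"
    and T: "heat_semigroup L T" "heat_kernel T P" and P: "Gaussian_estimates P"
  shows "\<exists>c>0. \<exists>\<omega>0. \<forall>\<omega> (F :: 'a set). \<omega>0 < \<omega> \<and> finite F \<and>
      (\<forall>x\<in>F. \<forall>y\<in>F. x \<noteq> y \<longrightarrow>
        ball x (\<omega> powr (- 1 / 2) / 2) \<inter> ball y (\<omega> powr (- 1 / 2) / 2) = {}) \<longrightarrow>
      c * real (card F) \<le> real (eigenvalue_count L \<omega>)"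
proof -
  have sa: "self_adjoint_operator L" "nonneg_operator L"
    using B by (auto simp: essentially_self_adjoint_with_smooth_algebra_def)
  have op: "bounded_kernel_operator (T t) (P t) M"
    if "0 < t" "\<And>x y. \<bar>P t x y\<bar> \<le> M" for t M
  proof
    show "(\<lambda>(x, y). P t x y) \<in> borel_measurable (mu \<Otimes>\<^sub>M mu)"
      using T(2) that(1) by (simp add: heat_kernel_def)
    show "AE x in mu. rep_l2 (T t f) x = (\<integral>y. P t x y * rep_l2 f y \<partial>mu)" for f
      using T(2) that(1) unfolding heat_kernel_def by (auto elim: eventually_mono)
  qed (rule that(2))
  have op_exists: "\<exists>M. bounded_kernel_operator (T t) (P t) M" if t: "0 < t" "t < 1" for t
  proof -
    obtain M where "\<And>x y. \<bar>P t x y\<bar> \<le> M"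
      using Gaussian_kernel_bound[OF q P t] t by blast
    then show ?thesis using op t by blast
  qed
  interpret heat: locally_bounded_heat_semigroup L T
  proof
    fix a :: real assume a: "0 < a" "a < 1"
    obtain M where M: "\<And>t x y. a \<le> t \<Longrightarrow> t < 1 \<Longrightarrow> \<bar>P t x y\<bar> \<le> M"
      using Gaussian_kernel_bound[OF q P a] by blast
    have "norm (T t f) \<le> M * measure mu (UNIV :: 'a set) * norm f" if "a \<le> t" "t < 1" for t f
      using bounded_kernel_operator.norm_le[OF op[OF _ M[OF that]]] that a by auto
    then show "\<exists>M. \<forall>t f. a \<le> t \<and> t < 1 \<longrightarrow> norm (T t f) \<le> M * norm f" by blast
  qed (use T(1) sa in auto)
  obtain C1 C2 c1 c2 where C: "0 < C1" "0 < C2" "0 < c1" "0 < c2"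
    and low: "\<And>t x y. 0 < t \<Longrightarrow> t < 1 \<Longrightarrow> C1 * exp (- (c1 * (dist x y)\<^sup>2 / t))
        / sqrt (measure mu (ball x (sqrt t)) * measure mu (ball y (sqrt t))) \<le> P t x y"
    and "\<And>t x y. 0 < t \<Longrightarrow> t < 1 \<Longrightarrow> P t x y \<le> C2 * exp (- (c2 * (dist x y)\<^sup>2 / t))
        / sqrt (measure mu (ball x (sqrt t)) * measure mu (ball y (sqrt t)))"
    by (rule Gaussian_estimatesE[OF P]) (rule that)
  have q1: "1 < q" using q by (simp add: doubling_const_def)
  define \<delta> where "\<delta> = C1 * exp (- c1)"
  have \<delta>: "0 < \<delta>" using C by (simp add: \<delta>_def)
  obtain k :: nat where k: "exp (- (4 ^ k)) * q ^ (k + 2) < \<delta>"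
    using super_exponential_decay[OF q1 \<delta>] .
  define c where "c = \<delta> / q ^ (k + 2) - exp (- (4 ^ k))"
  have c: "0 < c"
    using k q1 by (simp add: c_def pos_less_divide_eq)
  have "c * real (card F) \<le> real (eigenvalue_count L \<omega>)"
    if hyp: "4 ^ k < \<omega> \<and> finite F \<and> (\<forall>x\<in>F. \<forall>y\<in>F. x \<noteq> y \<longrightarrow>
        ball x (\<omega> powr (- 1 / 2) / 2) \<inter> ball y (\<omega> powr (- 1 / 2) / 2) = {})" for \<omega> and F :: "'a set"
  proof -
    from hyp have \<omega>: "4 ^ k < \<omega>" and F: "finite F"
      and disj: "\<And>x y. x \<in> F \<Longrightarrow> y \<in> F \<Longrightarrow> x \<noteq> y \<Longrightarrow>
        ball x (\<omega> powr (- 1 / 2) / 2) \<inter> ball y (\<omega> powr (- 1 / 2) / 2) = {}"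
      by blast+
    define \<rho> where "\<rho> = \<omega> powr (- 1 / 2)"
    have \<omega>0: "0 < \<omega>" using \<omega> by (meson less_trans zero_less_numeral zero_less_power)
    have \<rho>: "0 < \<rho>" "\<rho>\<^sup>2 = 1 / \<omega>"
      using \<omega>0 by (auto simp: \<rho>_def powr_minus_divide powr_half_sqrt power_divide)
    define t where "t = 4 ^ k / \<omega>"
    have t: "0 < t" "t < 1" using \<omega> \<omega>0 by (auto simp: t_def)
    have sqrt_t: "sqrt t = 2 ^ k * \<rho>"
    proof (rule real_sqrt_unique)
      have "(2 ^ k)\<^sup>2 = (4::real) ^ k"
        by (simp add: power2_eq_square flip: power_mult_distrib)
      then show "(2 ^ k * \<rho>)\<^sup>2 = t"
        unfolding power_mult_distrib \<rho>(2) t_def by simp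
    qed (use \<rho> in simp)
    define s where "s = t / 2"
    have s: "0 < s" "s < 1" "s + s = t" using t by (auto simp: s_def)
    obtain Ms where "bounded_kernel_operator (T s) (P s) Ms" using op_exists s by blast
    then interpret s: bounded_kernel_operator "T s" "P s" Ms .
    obtain Mt where "bounded_kernel_operator (T t) (P t) Mt" using op_exists t by blast
    then interpret t: bounded_kernel_operator "T t" "P t" Mt .
    obtain E where E: "heat.spectral_basis \<omega> E"
      using heat.spectral_basis_exists[OF s(1,2) s.Hilbert_Schmidt] .
    then have ob: "finite E" "orthonormal E" by (auto simp: heat.spectral_basis_def)
    define S where "S x = ball x (\<rho> / 2)" for x :: 'a
    define \<phi> where "\<phi> x = abs_l2 (unit_indicator (S x))" for x :: 'a
    have S_pos: "0 < measure mu (S x)" for x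
      using q \<rho> by (simp add: doubling_const_def S_def)
    have S_sets: "S x \<in> sets mu" for x by (simp add: S_def)
    have \<phi>_same: "inner (\<phi> x) (\<phi> x) = 1" for x
      unfolding \<phi>_def by (intro inner_unit_indicator_same S_sets S_pos)
    have \<phi>_disj: "inner (\<phi> x) (\<phi> y) = 0" if "x \<in> F" "y \<in> F" "x \<noteq> y" for x y
      unfolding \<phi>_def using disj[OF that]
      by (intro inner_unit_indicator_disjoint S_sets) (simp add: S_def \<rho>_def)
    have inj: "inj_on \<phi> F"
      using \<phi>_same \<phi>_disj by (intro inj_onI) (metis zero_neq_one)
    have on: "orthonormal (\<phi> ` F)"
      unfolding orthonormal_def using \<phi>_same \<phi>_disj by auto
    have lower: "\<delta> / q ^ (k + 2) \<le> inner (T t (\<phi> z)) (\<phi> z)" for z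
    proof -
      let ?V = "q ^ (k + 2) * measure mu (S z)"
      have V: "0 < ?V" using q1 S_pos by simp
      have "\<delta> / ?V \<le> P t x y" if xy: "x \<in> S z" "y \<in> S z" for x y
      proof -
        have vol: "0 < measure mu (ball w (sqrt t)) \<and> measure mu (ball w (sqrt t)) \<le> ?V" if "w \<in> S z" for w
        proof
          show "0 < measure mu (ball w (sqrt t))"
            using q t by (simp add: doubling_const_def)
          have "ball w (sqrt t) \<subseteq> ball z (2 ^ (k + 2) * (\<rho> / 2))"
          proof
            fix v assume "v \<in> ball w (sqrt t)"
            then have "dist z v < \<rho> / 2 + 2 ^ k * \<rho>"
              using that dist_triangle[of z v w] by (simp add: S_def sqrt_t)
            also have "\<dots> \<le> 2 ^ k * \<rho> + 2 ^ k * \<rho>"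
            proof -
              have "1 * \<rho> \<le> 2 ^ k * \<rho>" using \<rho>(1) by (intro mult_right_mono) auto
              then show ?thesis using \<rho>(1) by linarith
            qed
            finally show "v \<in> ball z (2 ^ (k + 2) * (\<rho> / 2))" by (simp add: power_add)
          qed
          then have "measure mu (ball w (sqrt t)) \<le> measure mu (ball z (2 ^ (k + 2) * (\<rho> / 2)))"
            by (rule measure_ball_mono)
          also have "\<dots> \<le> ?V"
            unfolding S_def using \<rho>(1) by (intro measure_ball_pow q) simp
          finally show "measure mu (ball w (sqrt t)) \<le> ?V" .
        qed
        have "dist x y \<le> \<rho>"
          using xy dist_triangle[of x y z] by (simp add: S_def dist_commute)
        then have "(dist x y)\<^sup>2 \<le> \<rho>\<^sup>2" by (intro power_mono) auto
        also have "\<dots> \<le> t"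
          using \<omega>0 by (simp add: \<rho>(2) t_def divide_right_mono)
        finally have "c1 * ((dist x y)\<^sup>2 / t) \<le> c1 * 1"
          using C t by (intro mult_left_mono) auto
        then have num: "\<delta> \<le> C1 * exp (- (c1 * (dist x y)\<^sup>2 / t))"
          unfolding \<delta>_def using C by simp
        have "measure mu (ball x (sqrt t)) * measure mu (ball y (sqrt t)) \<le> ?V * ?V"
          using vol[OF xy(1)] vol[OF xy(2)] V by (intro mult_mono) auto
        then have "sqrt (measure mu (ball x (sqrt t)) * measure mu (ball y (sqrt t))) \<le> ?V"
          using V by (intro real_le_lsqrt) (auto simp: power2_eq_square)
        then have "\<delta> / ?V \<le> C1 * exp (- (c1 * (dist x y)\<^sup>2 / t))
            / sqrt (measure mu (ball x (sqrt t)) * measure mu (ball y (sqrt t)))"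
          using num vol[OF xy(1)] vol[OF xy(2)] \<delta> by (intro frac_le) auto
        also have "\<dots> \<le> P t x y" using low t by blast
        finally show ?thesis .
      qed
      then have "\<delta> / ?V * measure mu (S z) \<le> inner (T t (\<phi> z)) (\<phi> z)"
        unfolding \<phi>_def by (intro t.inner_unit_indicator_ge S_sets S_pos)
      then show ?thesis using S_pos[of z] by simp
    qed
    have upper: "inner (T t (\<phi> z)) (\<phi> z) \<le> (\<Sum>e\<in>E. (inner (\<phi> z) e)\<^sup>2) + exp (- (4 ^ k))" for z
    proof -
      have "inner (T (s + s) (\<phi> z)) (\<phi> z) \<le>
          (\<Sum>e\<in>E. (inner (\<phi> z) e)\<^sup>2) + exp (- \<omega> * (s + s)) * (norm (\<phi> z))\<^sup>2"
        by (rule heat.inner_T_le[OF s(1) _ E])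
          (use s t in simp, rule s.square_compact[OF heat.bounded_linear_T], use s in auto)
      moreover have "\<omega> * t = 4 ^ k" using \<omega>0 by (simp add: t_def)
      ultimately show ?thesis
        by (simp add: s(3) power2_norm_eq_inner \<phi>_same)
    qed
    have "real (card F) * (\<delta> / q ^ (k + 2)) \<le> (\<Sum>z\<in>F. (\<Sum>e\<in>E. (inner (\<phi> z) e)\<^sup>2) + exp (- (4 ^ k)))"
      using sum_mono[of F "\<lambda>_. \<delta> / q ^ (k + 2)", OF order_trans[OF lower upper]] by simp
    also have "\<dots> = (\<Sum>e\<in>E. \<Sum>z\<in>F. (inner e (\<phi> z))\<^sup>2) + real (card F) * exp (- (4 ^ k))"
      by (simp add: sum.distrib inner_commute) (rule sum.swap)
    also have "\<dots> \<le> (\<Sum>e\<in>E. 1) + real (card F) * exp (- (4 ^ k))"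
    proof (intro add_right_mono sum_mono)
      fix e assume e: "e \<in> E"
      have "(\<Sum>z\<in>F. (inner e (\<phi> z))\<^sup>2) = (\<Sum>f\<in>\<phi> ` F. (inner e f)\<^sup>2)"
        by (simp add: sum.reindex[OF inj])
      also have "\<dots> \<le> (norm e)\<^sup>2"
        using F by (intro Bessel_inequality on) auto
      finally show "(\<Sum>z\<in>F. (inner e (\<phi> z))\<^sup>2) \<le> 1"
        using orthonormal_norm[OF ob(2) e] by simp
    qed
    finally show ?thesis
      using heat.card_spectral_basis[OF E] by (simp add: c_def algebra_simps)
  qed
  with c show ?thesis
    by (intro exI[of _ c] conjI exI[of _ "4 ^ k"] allI impI)
qed

lemma ecard_le_of_finite_subsets:
  assumes "\<And>F. finite F \<Longrightarrow> F \<subseteq> A \<Longrightarrow> real (card F) \<le> b"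
  shows "ecard A \<le> ennreal b"
proof (cases "finite A")
  case True
  then show ?thesis
    using assms[of A] by (simp add: ecard_def ennreal_of_nat_eq_real_of_nat ennreal_leI)
next
  case False
  obtain F where "finite F" "F \<subseteq> A" "card F = Suc (nat \<lceil>b\<rceil>)"
    using infinite_arbitrarily_large[OF False] by blast
  then have "real (Suc (nat \<lceil>b\<rceil>)) \<le> b" using assms by metis
  then show ?thesis by linarith
qed

theorem theorem5p2:
  fixes L :: "('a::compact_metric_measure_space l2 \<times> 'a l2) set" and N :: nat
  assumes A: "doubling TYPE('a)"
    and B: "essentially_self_adjoint_with_smooth_algebra L"
    and C: "energy_bound L"
    and D: "local_Poincare L"
    and E: "short_time_Gaussian_heat_kernel L"
    and N: "\<exists>\<rho>1>0. \<forall>\<rho>. 0 < \<rho> \<and> \<rho> < \<rho>1 \<longrightarrow> (\<exists>A::'a set. metric_lattice \<rho> N A)"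
  shows "\<exists>c::real. 0 < c \<and> c < 1 \<and>
           (\<forall>\<^sub>F \<omega> in at_top.
              ennreal c * (SUP A \<in> {A::'a set. metric_lattice (\<omega> powr (- 1 / 2)) N A}. ecard A)
                \<le> of_nat (eigenvalue_count L \<omega>))"
proof -
  obtain q where q: "doubling_const TYPE('a) q"
    using doubling_const_exists[OF A] .
  obtain T P where TP: "heat_semigroup L T" "heat_kernel T P" "Gaussian_estimates P"
    using E unfolding short_time_Gaussian_heat_kernel_def by blast
  obtain c \<omega>0 where c: "0 < c" and count: "\<forall>\<omega> (F :: 'a set). \<omega>0 < \<omega> \<and> finite F \<and>
      (\<forall>x\<in>F. \<forall>y\<in>F. x \<noteq> y \<longrightarrow>
        ball x (\<omega> powr (- 1 / 2) / 2) \<inter> ball y (\<omega> powr (- 1 / 2) / 2) = {}) \<longrightarrow>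
      c * real (card F) \<le> real (eigenvalue_count L \<omega>)"
    using card_lattice_le_eigenvalue_count[OF q B TP] by (elim exE conjE) (rule that)
  define c' where "c' = min c (1 / 2)"
  have c': "0 < c'" "c' < 1" "c' \<le> c" using c by (auto simp: c'_def)
  have "ennreal c' * (SUP A \<in> {A::'a set. metric_lattice (\<omega> powr (- 1 / 2)) N A}. ecard A)
      \<le> of_nat (eigenvalue_count L \<omega>)" if \<omega>: "\<omega>0 < \<omega>" for \<omega>
  proof -
    let ?n = "real (eigenvalue_count L \<omega>)"
    have "(SUP A \<in> {A::'a set. metric_lattice (\<omega> powr (- 1 / 2)) N A}. ecard A) \<le> ennreal (?n / c')"
    proof (rule SUP_least)
      fix A :: "'a set" assume A: "A \<in> {A. metric_lattice (\<omega> powr (- 1 / 2)) N A}"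
      show "ecard A \<le> ennreal (?n / c')"
      proof (rule ecard_le_of_finite_subsets)
        fix F assume F: "finite F" "F \<subseteq> A"
        have "\<forall>x\<in>F. \<forall>y\<in>F. x \<noteq> y \<longrightarrow>
            ball x (\<omega> powr (- 1 / 2) / 2) \<inter> ball y (\<omega> powr (- 1 / 2) / 2) = {}"
          using A F(2) unfolding metric_lattice_def by blast
        then have "c * real (card F) \<le> ?n" by (intro count[rule_format] conjI \<omega> F(1)) blast+
        moreover have "c' * real (card F) \<le> c * real (card F)"
          using c'(3) by (intro mult_right_mono) auto
        ultimately show "real (card F) \<le> ?n / c'"
          using c'(1) by (simp add: pos_le_divide_eq mult.commute)
      qed
    qed
    then have "ennreal c' * (SUP A \<in> {A::'a set. metric_lattice (\<omega> powr (- 1 / 2)) N A}. ecard A)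
        \<le> ennreal c' * ennreal (?n / c')"
      by (rule mult_left_mono) simp
    also have "\<dots> = of_nat (eigenvalue_count L \<omega>)"
      using c'(1) by (simp add: ennreal_mult[symmetric] ennreal_of_nat_eq_real_of_nat)
    finally show ?thesis .
  qed
  then have "\<forall>\<^sub>F \<omega> in at_top.
      ennreal c' * (SUP A \<in> {A::'a set. metric_lattice (\<omega> powr (- 1 / 2)) N A}. ecard A)
        \<le> of_nat (eigenvalue_count L \<omega>)"
    using eventually_gt_at_top[of \<omega>0] by (rule eventually_mono[rotated])
  then show ?thesis using c' by blast
qed

end
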